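(* Let $F, C, D\in B^a(H_{\mathcal A})$ and let $\mathbf M_C^{\mathcal A} = \begin{pmatrix} F & C \\ 0 & D\end{pmatrix}\in\mathcal M\Phi_+(H_{\mathcal A}\oplus H_{\mathcal A})$. Put $F' = \begin{pmatrix} F & 0\\ 0 & 1\end{pmatrix}$ and $D' = \begin{pmatrix} 1 & 0\\ 0 & D\end{pmatrix}$. Then $F'\in\mathcal M\Phi_+(H_{\mathcal A}\oplus H_{\mathcal A})$ and either $D\in\mathcal M\Phi_+(H_{\mathcal A})$ or there exist decompositions $$H_{\mathcal A}\oplus H_{\mathcal A} = M_1\tilde\oplus N_1 \stackrel{F'}{\longrightarrow} M_2\tilde\oplus N_2 = H_{\mathcal A}\oplus H_{\mathcal A},$$ $$H_{\mathcal A}\oplus H_{\mathcal A} = M_1'\tilde\oplus N_1' \stackrel{D'}{\longrightarrow} M_2'\tilde\oplus N_2' = H_{\mathcal A}\oplus H_{\mathcal A},$$ with respect to which $F', D'$ have the matrices $\begin{pmatrix} F_1' & 0\\ 0& F_4'\end{pmatrix}$, $\begin{pmatrix} D_1' & 0\\ 0& D_4'\end{pmatrix}$, respectively, where $F_1', D_1'$ are isomorphisms, $M_2\cong M_1'$ and $N_2\cong N_1'$, $N_1$ is finitely generated, and $N_2, N_1'$ are closed but not finitely generated.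
   Context: $\mathcal A$ is a unital $C^*$-algebra and $H_{\mathcal A} = \ell^2(\mathcal A)$ is the standard Hilbert $\mathcal A$-module. For a Hilbert $\mathcal A$-module $H$, $B^a(H)$ denotes the bounded adjointable $\mathcal A$-linear operators on $H$; $1$ denotes the identity operator. $H_{\mathcal A}\oplus H_{\mathcal A}$ is the (orthogonal) Hilbert module direct sum. $\tilde\oplus$ denotes a direct sum of closed submodules that need not be orthogonal. A Hilbert module is finitely generated if it equals the linear span (over $\mathbb C$ and $\mathcal A$) of a finite subset. An isomorphism is a bounded $\mathcal A$-linear bijection with bounded inverse, and $\cong$ means existence of an isomorphism. For a decomposition $H = M_1\tilde\oplus N_1 \stackrel{T}{\longrightarrow} M_2\tilde\oplus N_2 = H$ into closed submodules, saying $T$ has matrix $\begin{pmatrix} T_1 & 0\\ 0& T_4\end{pmatrix}$ means $T(M_1)\subseteq M_2$, $T(N_1)\subseteq N_2$, $T_1 = T|_{M_1}: M_1\to M_2$, $T_4 = T|_{N_1}:N_1\to N_2$. For $H = H_{\mathcal A}$ or $H_{\mathcal A}\oplus H_{\mathcal A}$, $T\in B^a(H)$ is upper semi-$\mathcal A$-Fredholm, $T\in\mathcal M\Phi_+(H)$, if there is such a decomposition with diagonal matrix, $T_1$ an isomorphism and $N_1$ finitely generated. *)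

theory Defs
  imports Complex_Main "HOL-Library.Function_Algebras" "HOL-Library.Product_Plus"
begin

class complex_vector = ab_group_add +
  fixes scaleC :: "complex \<Rightarrow> 'a \<Rightarrow> 'a"  (infixr \<open>*\<^sub>C\<close> 75)
  assumes scaleC_add_right: "c *\<^sub>C (x + y) = c *\<^sub>C x + c *\<^sub>C y"
    and scaleC_add_left: "(c + d) *\<^sub>C x = c *\<^sub>C x + d *\<^sub>C x"
    and scaleC_scaleC: "c *\<^sub>C d *\<^sub>C x = (c * d) *\<^sub>C x"
    and scaleC_one: "1 *\<^sub>C x = x"

instantiation "fun" :: (type, complex_vector) complex_vector
begin
definition scaleC_fun :: "complex \<Rightarrow> ('a \<Rightarrow> 'b) \<Rightarrow> 'a \<Rightarrow> 'b"
  where "scaleC_fun c f = (\<lambda>x. c *\<^sub>C f x)"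
instance
  by standard
    (auto simp: scaleC_fun_def fun_eq_iff scaleC_add_right scaleC_add_left scaleC_scaleC scaleC_one)
end

instantiation prod :: (complex_vector, complex_vector) complex_vector
begin
definition scaleC_prod :: "complex \<Rightarrow> 'a \<times> 'b \<Rightarrow> 'a \<times> 'b"
  where "scaleC_prod c p = (c *\<^sub>C fst p, c *\<^sub>C snd p)"
instance
  by standard
    (auto simp: scaleC_prod_def prod_eq_iff scaleC_add_right scaleC_add_left scaleC_scaleC scaleC_one)
end

text \<open>Unital \<open>C\<^sup>*\<close>-algebras. The unit is nonzero, with norm 1, as required by
  \<^class>\<open>real_normed_algebra_1\<close>.\<close>

class unital_cstar_algebra = complex_vector + real_normed_algebra_1 + banach +
  fixes star :: "'a \<Rightarrow> 'a"
  assumes scaleR_scaleC: "r *\<^sub>R a = complex_of_real r *\<^sub>C a"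
    and norm_scaleC: "norm (c *\<^sub>C a) = cmod c * norm a"
    and mult_scaleC_left: "(c *\<^sub>C a) * b = c *\<^sub>C (a * b)"
    and mult_scaleC_right: "a * (c *\<^sub>C b) = c *\<^sub>C (a * b)"
    and star_star: "star (star a) = a"
    and star_add: "star (a + b) = star a + star b"
    and star_scaleC: "star (c *\<^sub>C a) = cnj c *\<^sub>C star a"
    and star_mult: "star (a * b) = star b * star a"
    and norm_star_mult_self: "norm (star a * a) = norm a ^ 2"

text \<open>Data of a right Hilbert module: underlying set, right action of the algebra, and inner product
  (linear in the second argument). Addition and complex scalars are those of the ambient type. The
  record carries no axioms; it is only instantiated with the standard module, with direct sums,
  and with submodules of these. The operators below are HOL functions on the ambient type, and only
  their values on the underlying set matter.\<close>

record ('a, 'h) hmod =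
  hset :: "'h set"
  hact :: "'h \<Rightarrow> 'a \<Rightarrow> 'h"
  hinner :: "'h \<Rightarrow> 'h \<Rightarrow> 'a"

definition hnorm :: "('a::unital_cstar_algebra, 'h) hmod \<Rightarrow> 'h \<Rightarrow> real"
  where "hnorm H x = sqrt (norm (hinner H x x))"

definition submodule :: "('a::unital_cstar_algebra, 'h::complex_vector) hmod \<Rightarrow> 'h set \<Rightarrow> bool"
  where "submodule H M \<longleftrightarrow> M \<subseteq> hset H \<and> 0 \<in> M \<and> (\<forall>x\<in>M. \<forall>y\<in>M. x + y \<in> M) \<and>
    (\<forall>x\<in>M. \<forall>c. c *\<^sub>C x \<in> M) \<and> (\<forall>x\<in>M. \<forall>a. hact H x a \<in> M)"

definition closed_submodule ::
    "('a::unital_cstar_algebra, 'h::complex_vector) hmod \<Rightarrow> 'h set \<Rightarrow> bool"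
  where "closed_submodule H M \<longleftrightarrow> submodule H M \<and>
    (\<forall>s x. (\<forall>n. s n \<in> M) \<longrightarrow> x \<in> hset H \<longrightarrow> (\<lambda>n. hnorm H (s n - x)) \<longlonglongrightarrow> 0 \<longrightarrow> x \<in> M)"

abbreviation sub_hmod :: "('a, 'h) hmod \<Rightarrow> 'h set \<Rightarrow> ('a, 'h) hmod"  (infixl \<open>\<restriction>\<^sub>h\<close> 80)
  where "H \<restriction>\<^sub>h M \<equiv> H\<lparr>hset := M\<rparr>"

definition finitely_generated :: "('a::unital_cstar_algebra, 'h::complex_vector) hmod \<Rightarrow> bool"
  where "finitely_generated H \<longleftrightarrow> (\<exists>S. finite S \<and> S \<subseteq> hset H \<and>
    hset H = {\<Sum>x\<in>S. c x *\<^sub>C x + hact H x (a x) | c a. True})"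

definition bounded_module_map ::
    "('a::unital_cstar_algebra, 'h::complex_vector) hmod \<Rightarrow> ('a, 'k::complex_vector) hmod
      \<Rightarrow> ('h \<Rightarrow> 'k) \<Rightarrow> bool"
  where "bounded_module_map H K T \<longleftrightarrow>
    T ` hset H \<subseteq> hset K \<and>
    (\<forall>x\<in>hset H. \<forall>y\<in>hset H. T (x + y) = T x + T y) \<and>
    (\<forall>x\<in>hset H. \<forall>c. T (c *\<^sub>C x) = c *\<^sub>C T x) \<and>
    (\<forall>x\<in>hset H. \<forall>a. T (hact H x a) = hact K (T x) a) \<and>
    (\<exists>B. \<forall>x\<in>hset H. hnorm K (T x) \<le> B * hnorm H x)"

definition adjointable_ops ::
    "('a::unital_cstar_algebra, 'h::complex_vector) hmod \<Rightarrow> ('h \<Rightarrow> 'h) set"  (\<open>B\<^sup>a\<close>)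
  where "B\<^sup>a H = {T. bounded_module_map H H T \<and>
    (\<exists>S. S ` hset H \<subseteq> hset H \<and>
      (\<forall>x\<in>hset H. \<forall>y\<in>hset H. hinner H (T x) y = hinner H x (S y)))}"

definition module_iso ::
    "('a::unital_cstar_algebra, 'h::complex_vector) hmod \<Rightarrow> ('a, 'k::complex_vector) hmod
      \<Rightarrow> ('h \<Rightarrow> 'k) \<Rightarrow> bool"
  where "module_iso H K U \<longleftrightarrow> bounded_module_map H K U \<and> bij_betw U (hset H) (hset K) \<and>
    bounded_module_map K H (inv_into (hset H) U)"

definition isomorphic_modules ::
    "('a::unital_cstar_algebra, 'h::complex_vector) hmod \<Rightarrow> ('a, 'k::complex_vector) hmod \<Rightarrow> bool"
    (infix \<open>\<cong>\<^sub>h\<close> 50)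
  where "H \<cong>\<^sub>h K \<longleftrightarrow> (\<exists>U. module_iso H K U)"

definition direct_decomp ::
    "('a::unital_cstar_algebra, 'h::complex_vector) hmod \<Rightarrow> 'h set \<Rightarrow> 'h set \<Rightarrow> bool"
  where "direct_decomp H M N \<longleftrightarrow> closed_submodule H M \<and> closed_submodule H N \<and>
    M \<inter> N = {0} \<and> hset H = {m + n | m n. m \<in> M \<and> n \<in> N}"

definition diag_iso_decomp ::
    "('a::unital_cstar_algebra, 'h::complex_vector) hmod \<Rightarrow> ('h \<Rightarrow> 'h)
      \<Rightarrow> 'h set \<Rightarrow> 'h set \<Rightarrow> 'h set \<Rightarrow> 'h set \<Rightarrow> bool"
  where "diag_iso_decomp H T M1 N1 M2 N2 \<longleftrightarrow>
    direct_decomp H M1 N1 \<and> direct_decomp H M2 N2 \<and> T ` M1 \<subseteq> M2 \<and> T ` N1 \<subseteq> N2 \<and>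
    module_iso (H \<restriction>\<^sub>h M1) (H \<restriction>\<^sub>h M2) T"

definition upper_semi_Fredholm ::
    "('a::unital_cstar_algebra, 'h::complex_vector) hmod \<Rightarrow> ('h \<Rightarrow> 'h) set"  (\<open>M\<Phi>\<^sub>+\<close>)
  where "M\<Phi>\<^sub>+ H = {T \<in> B\<^sup>a H. \<exists>M1 N1 M2 N2.
    diag_iso_decomp H T M1 N1 M2 N2 \<and> finitely_generated (H \<restriction>\<^sub>h N1)}"

definition std_hmod :: "('a::unital_cstar_algebra, nat \<Rightarrow> 'a) hmod"  (\<open>H\<^sub>A\<close>)
  where "H\<^sub>A = \<lparr>hset = {x. summable (\<lambda>n. star (x n) * x n)},
    hact = (\<lambda>x a n. x n * a),
    hinner = (\<lambda>x y. \<Sum>n. star (x n) * y n)\<rparr>"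

definition hsum :: "('a::unital_cstar_algebra, 'h) hmod \<Rightarrow> ('a, 'k) hmod \<Rightarrow> ('a, 'h \<times> 'k) hmod"
    (infixr \<open>\<oplus>\<^sub>h\<close> 65)
  where "H \<oplus>\<^sub>h K = \<lparr>hset = hset H \<times> hset K,
    hact = (\<lambda>p a. (hact H (fst p) a, hact K (snd p) a)),
    hinner = (\<lambda>p q. hinner H (fst p) (fst q) + hinner K (snd p) (snd q))\<rparr>"

definition op_matrix ::
    "('h \<Rightarrow> 'h) \<Rightarrow> ('k \<Rightarrow> 'h) \<Rightarrow> ('h \<Rightarrow> 'k) \<Rightarrow> ('k \<Rightarrow> 'k)
      \<Rightarrow> 'h::complex_vector \<times> 'k::complex_vector \<Rightarrow> 'h \<times> 'k"
  where "op_matrix P Q R S = (\<lambda>(x, y). (P x + Q y, R x + S y))"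

end

theory Submission
  imports Defs "HOL-Analysis.Analysis"
begin

text \<open>
  The operator matrix factors as \<open>D' C' F'\<close>, where \<open>C'\<close> is the invertible matrix with entries
  \<open>1, C, 0, 1\<close>. If \<open>T P\<close> is diagonal with respect to \<open>M1 \<oplus> N1\<close> and \<open>M2 \<oplus> N2\<close>, then the middle
  decomposition \<open>P(M1) \<oplus> T\<^sup>-\<^sup>1(N2)\<close> diagonalises both \<open>P\<close> and \<open>T\<close>. Applied twice, this yields
  decompositions for \<open>F'\<close> and \<open>D'\<close> whose middle summands are matched by \<open>C'\<close>.

  It remains to see that \<open>D\<close> is upper semi-Fredholm once the complement \<open>N\<close> for \<open>D'\<close> is finitely
  generated. The projection onto \<open>N\<close> need not be adjointable, so it cannot be approximated by its
  truncations from the right. By the open mapping theorem, however, elements of the unit ball of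
  \<open>N\<close> have uniformly small tails, so truncating from the left suffices: a left inverse of \<open>D'\<close>
  modulo \<open>N\<close>, compressed to tails, is an approximate left inverse of \<open>D\<close> on the sequences
  vanishing on a long initial segment, and a contraction argument makes it exact.
\<close>

text \<open>The alternative in the conclusion is one case distinction: \<open>C'\<close> maps the
  middle complement of \<open>F'\<close> isomorphically onto that of \<open>D'\<close>, so both are
  finitely generated or neither is. Passing from \<open>D'\<close> to \<open>D\<close> is the real
  obstacle, because the summands found for \<open>D'\<close> need not respect the two coordinates
  and cannot be cut down to one of them. What survives compression to the second coordinate is a
  left inverse modulo \<open>N\<close>; its boundedness needs that of the oblique projection of a
  direct decomposition, a first use of the open mapping theorem. A second use bounds the
  coefficients of an element of \<open>N\<close> by its norm, so that the tails of finitely many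
  generators control all of \<open>N\<close>. The tail submodule then serves as a summand of the
  domain of \<open>D\<close>, and its complement is finitely generated because finitely many unit
  vectors span the rest. Since norms are read off an algebra-valued inner product, even the triangle
  inequality and the comparison of partial sums rest on positivity of \<open>star a * a\<close>,
  which is not among the axioms and has to be derived from the C*-identity.\<close>

lemma scaleC_zero_left [simp]: "0 *\<^sub>C x = (0::'a::complex_vector)"
  using scaleC_add_left[of 0 0 x] by simp

lemma scaleC_minus1: "(-1) *\<^sub>C x = - (x::'a::complex_vector)"
proof -
  have "(-1) *\<^sub>C x + x = ((-1) + 1) *\<^sub>C x" by (simp only: scaleC_add_left scaleC_one)
  then show ?thesis by (simp add: eq_neg_iff_add_eq_0)
qed

lemma scaleC_minus_left: "(- c) *\<^sub>C x = - (c *\<^sub>C (x::'a::complex_vector))"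
  using scaleC_scaleC[of "-1" c x] by (simp add: scaleC_minus1)

lemma scaleC_minus_right: "c *\<^sub>C (- x) = - (c *\<^sub>C (x::'a::complex_vector))"
  using scaleC_scaleC[of c "-1" x] by (simp add: scaleC_minus1 scaleC_minus_left scaleC_one)

lemma scaleC_sum: "c *\<^sub>C sum f I = (\<Sum>i\<in>I. c *\<^sub>C (f i :: 'a::complex_vector))"
  using scaleC_add_right[of c 0 0]
  by (induction I rule: infinite_finite_induct) (auto simp: scaleC_add_right)

section \<open>Positive elements of a \<open>C\<^sup>*\<close>-algebra\<close>

context
  notes [simp] = star_star star_add star_mult star_scaleC
begin

section \<open>The involution, and square roots near the unit\<close>

lemma star_scaleR [simp]: "star (r *\<^sub>R a) = r *\<^sub>R star (a::'a::unital_cstar_algebra)"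
  by (simp add: scaleR_scaleC)

lemma star_0 [simp]: "star 0 = (0::'a::unital_cstar_algebra)"
  using star_scaleR[of 0 0] by simp

lemma star_minus [simp]: "star (- a) = - star (a::'a::unital_cstar_algebra)"
  using star_scaleR[of "-1" a] by simp

lemma star_diff [simp]: "star (a - b) = star a - star (b::'a::unital_cstar_algebra)"
  using star_add[of a "- b"] by simp

lemma star_1 [simp]: "star 1 = (1::'a::unital_cstar_algebra)"
proof -
  have "star 1 * (1::'a) = star (star 1 * 1)" by (simp only: star_mult star_star)
  then show ?thesis by simp
qed

lemma star_sum: "star (sum f I) = (\<Sum>i\<in>I. star (f i :: 'a::unital_cstar_algebra))"
  by (induction I rule: infinite_finite_induct) auto

text \<open>The C*-identity and submultiplicativity give
  \<open>norm b * norm b \<le> norm (star b) * norm b\<close>; cancelling, for \<open>a\<close> and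
  for \<open>star a\<close>, gives both inequalities.\<close>

lemma norm_star [simp]: "norm (star a) = norm (a::'a::unital_cstar_algebra)"
proof -
  have le: "norm b \<le> norm (star b)" for b :: 'a
  proof (cases "b = 0")
    case False
    have "norm b * norm b \<le> norm (star b) * norm b"
      using norm_mult_ineq[of "star b" b] by (simp add: norm_star_mult_self power2_eq_square)
    then show ?thesis using False by simp
  qed auto
  show ?thesis using le[of a] le[of "star a"] by simp
qed

lemma bounded_linear_star: "bounded_linear (star :: 'a::unital_cstar_algebra \<Rightarrow> 'a)"
  by (rule bounded_linear_intro[where K = 1]) auto

lemmas tendsto_star = bounded_linear.tendsto[OF bounded_linear_star]

lemma norm_sa_square: "norm (k * k) = (norm k)\<^sup>2" if "star k = (k::'a::unital_cstar_algebra)"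
  using norm_star_mult_self[of k] that by simp

lemma sa_square_eq_0: "k = 0" if "star k = (k::'a::unital_cstar_algebra)" "k * k = 0"
  using norm_sa_square[OF that(1)] that(2) by simp

text \<open>The iteration \<open>y \<mapsto> (x + y\<^sup>2) / 2\<close> with \<open>x = 1 - h\<close> converges to a solution of \<open>(1 - y)\<^sup>2 = h\<close>;
  its increments are dominated by those of the scalar iteration started with \<open>x = 1\<close>.\<close>

lemma sqrt_exists_norm_le_1:
  fixes h :: "'a::unital_cstar_algebra"
  assumes sa: "star h = h" and h: "norm (1 - h) \<le> 1"
  shows "\<exists>k. star k = k \<and> k * k = h \<and> (\<forall>x. x * h = h * x \<longrightarrow> x * k = k * x) \<and> norm (1 - k) \<le> 1"
proof -
  define x where "x = 1 - h"
  define y where "y = rec_nat 0 (\<lambda>_ y. (1/2) *\<^sub>R (x + y * y))"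
  define r where "r = rec_nat 0 (\<lambda>_ r. (1/2) * (1 + r * r :: real))"
  have y0: "y 0 = 0" and yS: "y (Suc n) = (1/2) *\<^sub>R (x + y n * y n)" for n
    by (auto simp: y_def)
  have r0: "r 0 = 0" and rS: "r (Suc n) = (1/2) * (1 + r n * r n)" for n
    by (auto simp: r_def)
  have r1: "0 \<le> r n \<and> r n \<le> 1" for n
    by (induction n) (auto simp: r0 rS mult_le_one)
  have rmono: "r n \<le> r (Suc n)" for n
    using zero_le_power2[of "r n - 1"] by (simp add: rS power2_eq_square algebra_simps)
  have yle: "norm (y n) \<le> r n" for n
  proof (induction n)
    case (Suc n)
    have "norm (y n * y n) \<le> r n * r n"
      by (rule order_trans[OF norm_mult_ineq mult_mono]) (use Suc r1[of n] in auto)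
    then show ?case using h norm_triangle_ineq[of x "y n * y n"] by (simp add: yS rS x_def)
  qed (auto simp: y0 r0)
  have ydiff: "norm (y (Suc n) - y n) \<le> r (Suc n) - r n" for n
  proof (induction n)
    case 0
    then show ?case using yle[of 1] by (simp add: y0 r0)
  next
    case (Suc n)
    \<comment> \<open>This splitting of \<open>v * v - u * u\<close> holds without commutativity, so
      the increments of \<open>y\<close> obey as an inequality the recursion that those of
      \<open>r\<close> satisfy with equality.\<close>
    have "(1/2) *\<^sub>R (x + v * v) - (1/2) *\<^sub>R (x + u * u) = (1/2) *\<^sub>R (v * (v - u) + (v - u) * u)"
      for u v :: 'a by (simp add: algebra_simps)
    then have "y (Suc (Suc n)) - y (Suc n) =
        (1/2) *\<^sub>R (y (Suc n) * (y (Suc n) - y n) + (y (Suc n) - y n) * y n)"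
      by (metis yS)
    also have "norm \<dots> \<le> (1/2) * (r (Suc n) * (r (Suc n) - r n) + (r (Suc n) - r n) * r n)"
      by (simp, intro norm_triangle_le add_mono order_trans[OF norm_mult_ineq mult_mono])
         (use Suc yle r1 rmono in auto)
    also have "\<dots> = r (Suc (Suc n)) - r (Suc n)"
    proof -
      have "(1/2) * (v * (v - u) + (v - u) * u) = (1/2) * (1 + v * v) - (1/2) * (1 + u * u)"
        for u v :: real by (simp add: algebra_simps)
      then show ?thesis by (metis rS)
    qed
    finally show ?case .
  qed
  \<comment> \<open>\<open>r\<close> increases and stays below 1, so its increments telescope to a
    convergent series, which majorises the increments of \<open>y\<close>.\<close>
  have "convergent r"
    by (rule Bseq_mono_convergent[OF BseqI'[of _ 1]]) (use r1 rmono in \<open>auto intro: mono_SucI1 simp: abs_le_iff incseq_SucI[unfolded incseq_def, rule_format]\<close>)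
  then have "summable (\<lambda>n. r (Suc n) - r n)"
    using telescope_summable convergent_LIMSEQ_iff by blast
  then have "summable (\<lambda>n. y (Suc n) - y n)"
    by (rule summable_comparison_test') (use ydiff in auto)
  then obtain l where "(\<lambda>n. \<Sum>k<n. y (Suc k) - y k) \<longlonglongrightarrow> l"
    by (auto simp: summable_def sums_def)
  then have ylim: "y \<longlonglongrightarrow> l"
    by (simp add: sum_lessThan_telescope y0)
  have "(\<lambda>n. y (Suc n)) \<longlonglongrightarrow> (1/2) *\<^sub>R (x + l * l)"
    unfolding yS by (intro tendsto_intros ylim)
  then have leq: "l = (1/2) *\<^sub>R (x + l * l)"
    using LIMSEQ_unique LIMSEQ_Suc[OF ylim] by blast
  have "2 *\<^sub>R l = x + l * l" by (subst leq) simp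
  then have sq: "(1 - l) * (1 - l) = h"
    by (simp add: x_def algebra_simps scaleR_2)
  have "star (y n) = y n" for n by (induction n) (auto simp: y0 yS x_def sa)
  then have "star (1 - l) = 1 - l"
    using LIMSEQ_unique[OF tendsto_star[OF ylim]] ylim by simp
  moreover have "z * (1 - l) = (1 - l) * z" if z: "z * h = h * z" for z
  proof -
    have "z * y n = y n * z" for n
    proof (induction n)
      case (Suc n)
      have "z * (y n * y n) = y n * y n * z" using Suc by (metis mult.assoc)
      then show ?case using z by (simp add: yS x_def algebra_simps)
    qed (simp add: y0)
    then have "z * l = l * z"
      by (intro LIMSEQ_unique[OF tendsto_mult[OF tendsto_const ylim]])
         (simp add: tendsto_mult[OF ylim tendsto_const])
    then show ?thesis by (simp add: algebra_simps)
  qed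
  moreover have "norm (1 - (1 - l)) \<le> 1"
    unfolding diff_diff_eq2 add_diff_cancel_left'
    by (rule LIMSEQ_le_const2[OF tendsto_norm[OF ylim]]) (use yle r1 order_trans in blast)
  ultimately show ?thesis using sq by blast
qed

text \<open>\<open>u = a + i b\<close> is unitary because \<open>a\<close> and \<open>b\<close>
  commute, so it has norm 1, and \<open>a\<close> is the mean of \<open>u\<close> and
  \<open>star u\<close>.\<close>

lemma norm_le_1_if_squares_sum_1:
  fixes a b :: "'a::unital_cstar_algebra"
  assumes "star a = a" "star b = b" "a * b = b * a" "a * a + b * b = 1"
  shows "norm a \<le> 1"
proof -
  define c where "c = \<i> *\<^sub>C b"
  define u where "u = a + c"
  have "(- \<i>) *\<^sub>C b = - c"
    using scaleC_scaleC[of "-1" "\<i>" b] by (simp add: c_def scaleC_minus1)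
  then have su: "star u = a - c" using assms by (simp add: u_def c_def)
  have "a * c = c * a" "c * c = - (b * b)"
    using assms by (simp_all add: c_def mult_scaleC_left mult_scaleC_right scaleC_scaleC scaleC_minus1)
  then have "star u * u = a * a + b * b"
    unfolding su unfolding u_def by (simp add: algebra_simps)
  then have "(norm u)\<^sup>2 = 1" using assms norm_star_mult_self[of u] by simp
  then have nu: "norm u = 1" using norm_ge_zero[of u] by (auto simp: power2_eq_1_iff)
  have "u + star u = 2 *\<^sub>R a"
    unfolding su unfolding u_def by (simp add: scaleR_2)
  then have "2 * norm a \<le> 2"
    using norm_triangle_ineq[of u "star u"] nu by simp
  then show ?thesis by simp
qed

text \<open>\<open>1 - k * k\<close> has a self-adjoint root \<open>s\<close> commuting with
  \<open>k\<close>, and \<open>s * s + k * k = 1\<close> forces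
  \<open>norm s \<le> 1\<close>.\<close>

lemma norm_one_minus_square_le_1:
  fixes k :: "'a::unital_cstar_algebra"
  assumes "star k = k" "norm k \<le> 1"
  shows "norm (1 - k * k) \<le> 1"
proof -
  have le: "norm (1 - (1 - k * k)) \<le> 1"
    using assms by (simp add: norm_sa_square power_le_one)
  have sa: "star (1 - k * k) = 1 - k * k"
    using assms by simp
  obtain s where s: "star s = s" "s * s = 1 - k * k"
      "\<And>x. x * (1 - k * k) = (1 - k * k) * x \<Longrightarrow> x * s = s * x"
    using sqrt_exists_norm_le_1[OF sa le] by blast
  have "k * s = s * k" by (rule s) (simp add: algebra_simps)
  then have "norm s \<le> 1"
    by (intro norm_le_1_if_squares_sum_1[of s k]) (use s(1,2) assms in auto)
  then show ?thesis
    using s(1,2) by (metis norm_ge_zero norm_sa_square power_le_one)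
qed

text \<open>Kelley and Vaught's description of positivity: it makes the positive elements a convex cone
  without any spectral theory.\<close>

definition cpos :: "'a::unital_cstar_algebra \<Rightarrow> bool"
  where "cpos h \<longleftrightarrow> star h = h \<and> (\<exists>t. norm (t *\<^sub>R 1 - h) \<le> t)"

lemma cpos_sa: "cpos h \<Longrightarrow> star h = h"
  by (simp add: cpos_def)

lemma cpos_0: "cpos 0"
  by (auto simp: cpos_def intro: exI[of _ 0])

lemma cpos_add: "cpos h \<Longrightarrow> cpos k \<Longrightarrow> cpos (h + k)"
  unfolding cpos_def
proof (elim conjE exE, intro conjI exI)
  fix s t assume "norm (s *\<^sub>R 1 - h) \<le> s" "norm (t *\<^sub>R 1 - k) \<le> t"
  then show "norm ((s + t) *\<^sub>R 1 - (h + k)) \<le> s + t"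
    using norm_triangle_ineq[of "s *\<^sub>R 1 - h" "t *\<^sub>R 1 - k"] by (simp add: algebra_simps)
qed simp

lemma cpos_scaleR: "0 \<le> r \<Longrightarrow> cpos h \<Longrightarrow> cpos (r *\<^sub>R h)"
  unfolding cpos_def
proof (elim conjE exE, intro conjI exI)
  fix t assume "0 \<le> r" "norm (t *\<^sub>R 1 - h) \<le> t"
  then show "norm ((r * t) *\<^sub>R 1 - r *\<^sub>R h) \<le> r * t"
    by (simp flip: scaleR_scaleR scaleR_diff_right) (simp add: mult_left_mono)
qed simp

lemma cpos_sum: "(\<And>i. i \<in> I \<Longrightarrow> cpos (f i)) \<Longrightarrow> cpos (sum f I)"
  by (induction I rule: infinite_finite_induct) (auto simp: cpos_0 cpos_add)

lemma cpos_sub_scalar: "star h = h \<Longrightarrow> norm h \<le> r \<Longrightarrow> cpos (r *\<^sub>R 1 - h)"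
  by (auto simp: cpos_def intro: exI[of _ r])

text \<open>Scaling to norm 1 reduces this to the previous estimate. The witness for positivity is
  the norm itself, hence continuous in the element; closure of the cone under limits depends on
  this.\<close>

lemma norm_square_sub:
  fixes k :: "'a::unital_cstar_algebra"
  assumes "star k = k"
  shows "norm (norm (k * k) *\<^sub>R 1 - k * k) \<le> norm (k * k)"
proof (cases "k = 0")
  case False
  define c where "c = (1 / norm k) *\<^sub>R k"
  have "norm (1 - c * c) \<le> 1"
    using assms False by (intro norm_one_minus_square_le_1) (auto simp: c_def)
  moreover have "(norm k)\<^sup>2 *\<^sub>R (1 - c * c) = (norm k)\<^sup>2 *\<^sub>R 1 - k * k"
    using False by (simp add: c_def scaleR_diff_right power2_eq_square)
  ultimately show ?thesis
    using norm_scaleR[of "(norm k)\<^sup>2" "1 - c * c"] norm_sa_square[OF assms]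
    by (simp add: mult_left_le)
qed auto

lemma cpos_square: "star k = k \<Longrightarrow> cpos (k * k)"
  using norm_square_sub[of k] by (auto simp: cpos_def)

text \<open>Dividing by the witness \<open>t\<close> brings \<open>h\<close> within distance 1 of
  the unit, where the square root iteration converges; \<open>t = 0\<close> leaves only
  \<open>h = 0\<close>.\<close>

lemma cpos_sqrt:
  fixes h :: "'a::unital_cstar_algebra"
  assumes "cpos h"
  obtains k where "star k = k" "k * k = h" "\<And>x. x * h = h * x \<Longrightarrow> x * k = k * x"
proof -
  obtain t where t: "norm (t *\<^sub>R 1 - h) \<le> t" and sa: "star h = h"
    using assms by (auto simp: cpos_def)
  show thesis
  proof (cases "t = 0")
    case True
    then show thesis using t that[of 0] by simp
  next
    case False
    then have t0: "t > 0" using t norm_ge_zero[of "t *\<^sub>R 1 - h"] by linarith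
    have "norm (1 - (1/t) *\<^sub>R h) = (1/t) * norm (t *\<^sub>R 1 - h)"
      using t0 norm_scaleR[of "1/t" "t *\<^sub>R 1 - h"] by (simp add: scaleR_diff_right)
    also have "\<dots> \<le> 1" using t0 t by simp
    finally have le: "norm (1 - (1/t) *\<^sub>R h) \<le> 1" .
    obtain k where k: "star k = k" "k * k = (1/t) *\<^sub>R h"
      "\<And>x. x * ((1/t) *\<^sub>R h) = ((1/t) *\<^sub>R h) * x \<Longrightarrow> x * k = k * x"
      using sqrt_exists_norm_le_1[OF _ le] sa star_scaleR by metis
    show thesis
    proof (rule that[of "sqrt t *\<^sub>R k"])
      show "sqrt t *\<^sub>R k * sqrt t *\<^sub>R k = h" using t0 k(2) by simp
      show "x * sqrt t *\<^sub>R k = sqrt t *\<^sub>R k * x" if "x * h = h * x" for x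
        using k(3)[of x] that by simp
    qed (use k(1) in simp)
  qed
qed

lemma cpos_norm_sub: "cpos h \<Longrightarrow> norm (norm h *\<^sub>R 1 - h) \<le> norm h"
  using norm_square_sub by (metis cpos_sqrt)

lemma cpos_LIMSEQ:
  assumes "\<And>n::nat. cpos (f n)" and lim: "f \<longlonglongrightarrow> h"
  shows "cpos h"
proof -
  have "star h = h"
    using LIMSEQ_unique[OF tendsto_star[OF lim]] lim assms(1)[THEN cpos_sa] by simp
  moreover have "norm (norm h *\<^sub>R 1 - h) \<le> norm h"
    by (rule LIMSEQ_le[of "\<lambda>n. norm (norm (f n) *\<^sub>R 1 - f n)" _ "\<lambda>n. norm (f n)"])
       (use cpos_norm_sub[OF assms(1)] in \<open>auto intro!: tendsto_intros lim\<close>)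
  ultimately show ?thesis by (auto simp: cpos_def)
qed

text \<open>For \<open>g\<close> and \<open>1 - g\<close> positive, the roots \<open>a\<close> and
  \<open>b\<close> commute and their squares sum to 1, so \<open>a\<close>, and with it
  \<open>g\<close>, has norm at most 1. The general bound is scaled to this case with
  \<open>r + e\<close> in place of \<open>r\<close>, since \<open>r\<close> may be 0.\<close>

lemma norm_le_if_cpos_sub:
  fixes h :: "'a::unital_cstar_algebra"
  assumes "cpos h" "cpos (r *\<^sub>R 1 - h)" "0 \<le> r"
  shows "norm h \<le> r"
proof -
  have 1: "norm g \<le> 1" if g: "cpos g" "cpos (1 - g)" for g :: 'a
  proof -
    obtain a where a: "star a = a" "a * a = g" "\<And>x. x * g = g * x \<Longrightarrow> x * a = a * x"
      using cpos_sqrt[OF g(1)] by blast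
    obtain b where b: "star b = b" "b * b = 1 - g" "\<And>x. x * (1 - g) = (1 - g) * x \<Longrightarrow> x * b = b * x"
      using cpos_sqrt[OF g(2)] by blast
    have "a * g = g * a" using a(2) by (metis mult.assoc)
    then have "a * b = b * a" by (intro b(3)) (simp add: algebra_simps)
    then have "norm a \<le> 1" using norm_le_1_if_squares_sum_1[of a b] a(1,2) b(1,2) by simp
    then show ?thesis using a(1,2) by (metis norm_ge_zero norm_sa_square power_le_one)
  qed
  have "norm h \<le> r + e" if "e > 0" for e
  proof -
    have "cpos ((r + e) *\<^sub>R 1 - h)"
      using cpos_add[OF assms(2) cpos_sub_scalar[of 0 e]] that by (simp add: algebra_simps)
    then have "cpos ((1 / (r + e)) *\<^sub>R ((r + e) *\<^sub>R 1 - h))"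
      using assms that by (intro cpos_scaleR) auto
    then have "cpos (1 - (1 / (r + e)) *\<^sub>R h)"
      using assms that by (simp add: scaleR_diff_right)
    then have "norm ((1 / (r + e)) *\<^sub>R h) \<le> 1"
      using assms that by (intro 1) (auto intro: cpos_scaleR)
    then show ?thesis using assms that by (simp add: field_simps)
  qed
  then show ?thesis by (rule field_le_epsilon)
qed

lemma norm_mono_cpos: "norm h \<le> norm k" if "cpos h" "cpos (k - h)"
proof (rule norm_le_if_cpos_sub[OF that(1)])
  have "star k = k" using that[THEN cpos_sa] by simp
  then have "cpos ((norm k *\<^sub>R 1 - k) + (k - h))"
    using that by (intro cpos_add cpos_sub_scalar) auto
  then show "cpos (norm k *\<^sub>R 1 - h)" by simp
qed simp

text \<open>Powers \<open>(1 - p)\<^sup>k\<close> of linear growth already force \<open>\<parallel>1 - p\<parallel> \<le> 1\<close>.\<close>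

lemma cpos_if_growth:
  fixes p :: "'a::unital_cstar_algebra"
  assumes "star p = p" and bd: "\<And>k. norm (p * (1 - p) ^ k) \<le> B"
  shows "cpos p"
proof -
  define q where "q = 1 - p"
  have B: "0 \<le> B" using bd[of 0] norm_ge_zero order_trans by blast
  have pow: "norm (q ^ k) \<le> 1 + k * B" for k
  proof (induction k)
    case (Suc k)
    have "q ^ Suc k = q ^ k - p * q ^ k" by (simp add: q_def algebra_simps)
    then show ?case using Suc bd[of k] norm_triangle_ineq4[of "q ^ k" "p * q ^ k"]
      by (simp add: q_def algebra_simps)
  qed simp
  have star: "star (q ^ k) = q ^ k" for k
    by (induction k) (use assms in \<open>auto simp: q_def power_commutes\<close>)
  \<comment> \<open>Repeated squaring turns the C*-identity for self-adjoint elements into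
    multiplicativity of the norm along powers of two.\<close>
  have pow2: "norm (q ^ (2 ^ j)) = norm q ^ (2 ^ j)" for j
  proof (induction j)
    case (Suc j)
    have "norm (q ^ (2 ^ Suc j)) = (norm (q ^ 2 ^ j))\<^sup>2"
      using norm_sa_square[OF star[of "2 ^ j"]] by (simp add: mult_2 flip: power_add)
    then show ?case using Suc by (simp add: mult.commute flip: power_mult)
  qed simp
  have "norm q \<le> 1"
  proof (rule ccontr)
    assume "\<not> norm q \<le> 1"
    then obtain d where d: "norm q = 1 + d" "d > 0" by (metis add_diff_cancel_left' diff_add_cancel diff_gt_0_iff_gt not_le)
    \<comment> \<open>With \<open>m = 2 ^ j\<close>, Bernoulli makes \<open>norm q ^ (2 * m)\<close>
      at least quadratic in \<open>m\<close>, while \<open>pow\<close> keeps it linear; comparison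
      bounds \<open>m * d\<^sup>2\<close> by \<open>2 * B\<close>, which fails for large
      \<open>j\<close>.\<close>
    have "2 ^ j * d\<^sup>2 \<le> 2 * B" for j :: nat
    proof -
      define m where "m = (2::real) ^ j"
      have m: "m > 0" by (simp add: m_def)
      have "(1 + m * d)\<^sup>2 \<le> ((1 + d) ^ (2 ^ j))\<^sup>2"
        using Bernoulli_inequality[of d "2 ^ j"] d m by (intro power_mono) (auto simp: m_def)
      also have "\<dots> = norm q ^ (2 ^ Suc j)"
        by (simp add: d mult.commute flip: power_mult)
      also have "\<dots> \<le> 1 + 2 * m * B"
        using pow[of "2 ^ Suc j"] unfolding pow2 by (simp add: m_def)
      finally have "(1 + m * d)\<^sup>2 \<le> 1 + 2 * m * B" .
      moreover have "(1 + m * d)\<^sup>2 = 1 + 2 * (m * d) + m * (m * d\<^sup>2)"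
        by (simp add: power2_eq_square algebra_simps)
      moreover have "0 \<le> m * d" using m d by simp
      ultimately have "m * (m * d\<^sup>2) \<le> m * (2 * B)" by linarith
      then show ?thesis using m by (simp add: m_def)
    qed
    moreover obtain j where "2 * B / d\<^sup>2 < (2::real) ^ j"
      using real_arch_pow[of 2] by auto
    ultimately show False
      using d(2) by (metis divide_less_eq not_le zero_less_power)
  qed
  then show ?thesis using assms by (auto simp: cpos_def q_def intro!: exI[of _ 1])
qed


section \<open>Positive and negative parts, and positivity of \<open>star a * a\<close>\<close>

text \<open>Multiplied by \<open>p\<close>, the factors \<open>1 - p\<close> and
  \<open>w = 1 - (p + n)\<close> act alike because \<open>p\<close> and \<open>n\<close> annihilate
  each other, so \<open>p * (1 - p) ^ k = p * w ^ k\<close> stays bounded by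
  \<open>norm p\<close>.\<close>

lemma cpos_if_orthogonal:
  fixes p n :: "'a::unital_cstar_algebra"
  assumes "star p = p" "p * n = 0" "n * p = 0" "norm (1 - (p + n)) \<le> 1"
  shows "cpos p"
proof (rule cpos_if_growth[OF assms(1)])
  define w where "w = 1 - (p + n)"
  have pw: "p * w = w * p" using assms by (simp add: w_def algebra_simps)
  have eq: "p * (1 - p) ^ k = p * w ^ k" for k
  proof (induction k)
    case (Suc k)
    have "p * (1 - p) ^ Suc k = w * (p * (1 - p) ^ k)"
      using assms by (simp add: w_def algebra_simps flip: mult.assoc)
    also have "\<dots> = p * w ^ Suc k" by (simp add: Suc pw[symmetric] flip: mult.assoc)
    finally show ?case .
  qed simp
  fix k
  have "norm (w ^ k) \<le> 1"
    using assms(4) by (intro order_trans[OF norm_power_ineq] power_le_one) (auto simp: w_def)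
  then show "norm (p * (1 - p) ^ k) \<le> norm p"
    unfolding eq by (intro order_trans[OF norm_mult_ineq] mult_left_le) auto
qed

text \<open>\<open>w\<close> is the absolute value of the rescaled element \<open>g\<close>, whose
  positive and negative parts are \<open>(w + g) / 2\<close> and \<open>(w - g) / 2\<close>. These
  sum to \<open>w\<close>, which is within distance 1 of the unit, as the criterion for orthogonal
  pairs requires.\<close>

lemma orthogonal_decomposition:
  fixes h :: "'a::unital_cstar_algebra"
  assumes sa: "star h = h"
  obtains p n where "h = p - n" "p * n = 0" "n * p = 0" "cpos p" "cpos n"
proof -
  define t where "t = norm h + 1"
  define g where "g = (1 / t) *\<^sub>R h"
  have t: "t > 0" by (simp add: t_def add_nonneg_pos)
  have g: "star g = g" "norm g \<le> 1" "h = t *\<^sub>R g"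
    using t sa by (auto simp: g_def) (simp add: t_def)
  obtain w where w: "star w = w" "w * w = g * g" "\<And>x. x * (g * g) = (g * g) * x \<Longrightarrow> x * w = w * x"
      "norm (1 - w) \<le> 1"
    using sqrt_exists_norm_le_1[OF _ norm_one_minus_square_le_1[OF g(1,2)]] g(1) star_mult by metis
  have gw: "g * w = w * g" by (rule w(3)) (simp add: mult.assoc)
  define p where "p = (1/2) *\<^sub>R (w + g)"
  define n where "n = (1/2) *\<^sub>R (w - g)"
  have pn: "p * n = 0" "n * p = 0"
    using w(2) gw by (auto simp: p_def n_def algebra_simps)
  have sum: "p + n = w" "n + p = w"
    by (simp_all add: p_def n_def flip: scaleR_add_right)
  have "cpos p" "cpos n"
    using cpos_if_orthogonal[OF _ pn] cpos_if_orthogonal[OF _ pn(2,1)] w(1,4) g(1) sum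
    by (auto simp: p_def n_def)
  moreover have "p - n = g"
    by (simp add: p_def n_def flip: scaleR_diff_right)
  ultimately show thesis
    using t pn g by (intro that[of "t *\<^sub>R p" "t *\<^sub>R n"]) (auto intro: cpos_scaleR simp flip: scaleR_diff_right)
qed

text \<open>Up to a factor 2, \<open>b + star b\<close> and \<open>z\<close> are the real part and,
  up to sign, the imaginary part of \<open>b\<close>; the claimed element is half the sum of their
  squares.\<close>

lemma cpos_mult_star_add_star_mult: "cpos (b * star b + star b * b)"
proof -
  define z where "z = \<i> *\<^sub>C (b - star b)"
  have sz: "star z = z"
    using scaleC_minus_right[of \<i> "b - star b"] by (simp add: z_def scaleC_minus_left)
  have "z * z = - ((b - star b) * (b - star b))"
    by (simp add: z_def mult_scaleC_left mult_scaleC_right scaleC_scaleC scaleC_minus1)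
  then have "(b + star b) * (b + star b) + z * z = 2 *\<^sub>R (b * star b + star b * b)"
    by (simp add: algebra_simps scaleR_2)
  then have "(1/2) *\<^sub>R ((b + star b) * (b + star b) + z * z) = b * star b + star b * b"
    by simp
  moreover have "cpos ((b + star b) * (b + star b))"
    by (rule cpos_square) (simp add: add.commute)
  ultimately show ?thesis
    using cpos_square[OF sz] by (metis cpos_add cpos_scaleR half_gt_zero_iff less_eq_real_def zero_less_one)
qed

text \<open>With \<open>\<parallel>b\<parallel> = 1\<close> and \<open>Q = b b\<^sup>*\<close> one has \<open>Q + Q\<^sup>2 = b (1 - s\<^sup>2) b\<^sup>* \<le> 1\<close>; together with
  \<open>Q\<^sup>2 \<ge> 2 Q - 1\<close> this gives \<open>Q \<le> 2/3\<close>, whereas \<open>\<parallel>Q\<parallel> = 1\<close>.\<close>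

lemma star_mult_self_negative_imp_0:
  fixes b :: "'a::unital_cstar_algebra"
  assumes s: "star s = s" and b: "star b * b = - (s * s)"
  shows "b = 0"
proof (rule ccontr)
  assume "b \<noteq> 0"
  define c where "c = (1 / norm b) *\<^sub>R b"
  define u where "u = (1 / norm b) *\<^sub>R s"
  have c: "norm c = 1" and u: "star u = u" and cu: "star c * c = - (u * u)"
    using \<open>b \<noteq> 0\<close> s b by (auto simp: c_def u_def)
  define Q where "Q = c * star c"
  have sQ: "star Q = Q" by (simp add: Q_def)
  have "norm (star c * c) = 1" using c by (simp add: norm_star_mult_self)
  then have nu: "norm u = 1"
    using norm_sa_square[OF u] by (simp add: cu power2_eq_1_iff) (smt (verit) norm_ge_zero)
  have nQ: "norm Q = 1" using norm_star_mult_self[of "star c"] c by (simp add: Q_def)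
  \<comment> \<open>Since \<open>star c * c\<close> cancels \<open>u * u\<close>, this element is
    just \<open>Q\<close>: a negative square on one side forces positivity on the other.\<close>
  have "cpos (Q + star c * c + u * u)"
    using cpos_add[OF cpos_mult_star_add_star_mult[of c] cpos_square[OF u]] by (simp add: Q_def)
  then have pQ: "cpos Q" by (simp add: cu)
  have "Q + Q * Q = c * ((1 + star c * c) * star c)"
    by (simp add: Q_def algebra_simps)
  also have "norm \<dots> \<le> norm c * (norm (1 - u * u) * norm (star c))"
    by (intro order_trans[OF norm_mult_ineq] mult_left_mono order_trans[OF norm_mult_ineq])
       (auto simp: cu)
  also have "\<dots> \<le> 1" using norm_one_minus_square_le_1[of u] u nu c by simp
  finally have "cpos (1 *\<^sub>R 1 - (Q + Q * Q))"
    by (intro cpos_sub_scalar) (auto simp: sQ)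
  moreover have "cpos ((1 - Q) * (1 - Q))" by (rule cpos_square) (simp add: sQ)
  ultimately have "cpos (1 - (Q + Q * Q) + (1 - Q) * (1 - Q))"
    using cpos_add by fastforce
  also have "1 - (Q + Q * Q) + (1 - Q) * (1 - Q) = 2 *\<^sub>R 1 - 3 *\<^sub>R Q"
  proof -
    have "3 *\<^sub>R Q = Q + Q + Q" using scaleR_add_left[of 2 1 Q] by (simp add: scaleR_2)
    then show ?thesis by (simp add: algebra_simps scaleR_2)
  qed
  finally have "cpos ((1/3) *\<^sub>R (2 *\<^sub>R 1 - 3 *\<^sub>R Q))" by (intro cpos_scaleR) auto
  then have "cpos ((2/3) *\<^sub>R 1 - Q)" by (simp add: scaleR_diff_right)
  then have "norm Q \<le> 2/3" by (intro norm_le_if_cpos_sub pQ) auto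
  then show False using nQ by simp
qed

text \<open>Let \<open>n\<close> be the negative part of \<open>star a * a\<close> and
  \<open>r\<close> its root. Then \<open>star (a * n) * (a * n)\<close> is minus the cube of
  \<open>n\<close>, that is, minus the square of \<open>r * n\<close>, so \<open>a * n = 0\<close>
  by the previous lemma; hence \<open>r * n\<close>, \<open>n * n\<close> and finally
  \<open>n\<close> vanish.\<close>

theorem cpos_star_mult_self: "cpos (star a * (a::'a::unital_cstar_algebra))"
proof -
  have "star (star a * a) = star a * a" by simp
  then obtain p n where pn: "star a * a = p - n" "p * n = 0" "n * p = 0" "cpos p" "cpos n"
    by (rule orthogonal_decomposition)
  obtain r where r: "star r = r" "r * r = n" using pn(5) by (rule cpos_sqrt)
  have rn: "n * r = r * n" using r(2) by (metis mult.assoc)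
  have sn: "star n = n" using pn cpos_sa by blast
  have sr: "star (r * n) = r * n" by (simp add: sn r rn)
  have "star (a * n) * (a * n) = n * (star a * a) * n" by (simp add: sn mult.assoc)
  also have "\<dots> = - (n * n * n)" unfolding pn(1) by (simp add: left_diff_distrib right_diff_distrib pn(2,3))
  also have "n * n * n = (r * n) * (r * n)" by (metis r(2) rn mult.assoc)
  finally have eq: "star (a * n) * (a * n) = - ((r * n) * (r * n))" .
  then have "a * n = 0" by (rule star_mult_self_negative_imp_0[OF sr])
  then have "r * n = 0" using eq sr sa_square_eq_0[of "r * n"] by simp
  then have "n * n = 0" by (metis r(2) mult.assoc mult_zero_right)
  then have "n = 0" using sn sa_square_eq_0 by blast
  then show ?thesis using pn by simp
qed

lemma cpos_conj: "cpos h \<Longrightarrow> cpos (star a * h * a)"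
proof -
  assume "cpos h"
  then obtain k where "star k = k" "k * k = h" by (rule cpos_sqrt)
  then have "star a * h * a = star (k * a) * (k * a)" by (simp add: mult.assoc) (simp flip: mult.assoc)
  then show ?thesis by (metis cpos_star_mult_self)
qed

end

section \<open>Hilbert modules\<close>

lemma hnorm_nonneg [simp]: "0 \<le> hnorm H x"
  by (simp add: hnorm_def)

lemma hnorm_restrict [simp]: "hnorm (H \<restriction>\<^sub>h M) = hnorm H"
  by (simp add: fun_eq_iff hnorm_def)

lemma submodule_restrict [simp]: "submodule (H \<restriction>\<^sub>h M) M \<longleftrightarrow> 0 \<in> M \<and> (\<forall>x\<in>M. \<forall>y\<in>M. x + y \<in> M) \<and>
    (\<forall>x\<in>M. \<forall>c. c *\<^sub>C x \<in> M) \<and> (\<forall>x\<in>M. \<forall>a. hact H x a \<in> M)"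
  by (simp add: submodule_def)

lemma closed_submodule_limit:
  assumes "closed_submodule H M" "\<And>n. s n \<in> M" "x \<in> hset H" "(\<lambda>n. hnorm H (s n - x)) \<longlonglongrightarrow> 0"
  shows "x \<in> M"
  using assms unfolding closed_submodule_def by blast

section \<open>Algebra-valued semi-inner products and Cauchy-Schwarz\<close>

text \<open>Definiteness is left out so that inner products summed over a fixed index set, which do
  not see the other coordinates, are instances. Complex scalars are tied to the action of multiples
  of the unit, so spans over the complex numbers and the algebra reduce to spans over the
  algebra.\<close>

locale semi_inner_module =
  fixes H :: "('a::unital_cstar_algebra, 'h::complex_vector) hmod"
  assumes submodule_hset: "submodule H (hset H)"
    and act_add: "x \<in> hset H \<Longrightarrow> y \<in> hset H \<Longrightarrow> hact H (x + y) a = hact H x a + hact H y a"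
    and act_add_right: "x \<in> hset H \<Longrightarrow> hact H x (a + b) = hact H x a + hact H x b"
    and scaleC_eq_act: "x \<in> hset H \<Longrightarrow> c *\<^sub>C x = hact H x (c *\<^sub>C 1)"
    and inner_add: "x \<in> hset H \<Longrightarrow> y \<in> hset H \<Longrightarrow> z \<in> hset H \<Longrightarrow>
      hinner H x (y + z) = hinner H x y + hinner H x z"
    and inner_act: "x \<in> hset H \<Longrightarrow> y \<in> hset H \<Longrightarrow> hinner H x (hact H y a) = hinner H x y * a"
    and star_inner: "x \<in> hset H \<Longrightarrow> y \<in> hset H \<Longrightarrow> star (hinner H x y) = hinner H y x"
    and inner_pos: "x \<in> hset H \<Longrightarrow> cpos (hinner H x x)"
begin

lemma zero_closed [simp, intro]: "0 \<in> hset H"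
  and add_closed [simp, intro]: "x \<in> hset H \<Longrightarrow> y \<in> hset H \<Longrightarrow> x + y \<in> hset H"
  and scaleC_closed [simp, intro]: "x \<in> hset H \<Longrightarrow> c *\<^sub>C x \<in> hset H"
  and act_closed [simp, intro]: "x \<in> hset H \<Longrightarrow> hact H x a \<in> hset H"
  using submodule_hset by (auto simp: submodule_def)

lemma minus_closed [simp, intro]: "x \<in> hset H \<Longrightarrow> - x \<in> hset H"
  using scaleC_closed[of x "-1"] by (simp add: scaleC_minus1)

lemma diff_closed [simp, intro]: "x \<in> hset H \<Longrightarrow> y \<in> hset H \<Longrightarrow> x - y \<in> hset H"
  using add_closed[of x "- y"] by simp

lemma sum_closed [simp, intro]: "(\<And>i. i \<in> I \<Longrightarrow> f i \<in> hset H) \<Longrightarrow> sum f I \<in> hset H"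
  by (induction I rule: infinite_finite_induct) auto

lemma inner_scaleC:
  "x \<in> hset H \<Longrightarrow> y \<in> hset H \<Longrightarrow> hinner H x (c *\<^sub>C y) = c *\<^sub>C hinner H x y"
  using mult_scaleC_right[of "hinner H x y" c 1] by (simp add: scaleC_eq_act inner_act)

lemma inner_minus: "x \<in> hset H \<Longrightarrow> y \<in> hset H \<Longrightarrow> hinner H x (- y) = - hinner H x y"
  using inner_scaleC[of x y "-1"] by (simp add: scaleC_minus1)

lemma inner_add_left: "x \<in> hset H \<Longrightarrow> y \<in> hset H \<Longrightarrow> z \<in> hset H \<Longrightarrow>
    hinner H (x + y) z = hinner H x z + hinner H y z"
  using inner_add[of z x y] by (metis add_closed star_add star_inner)

lemma inner_act_left: "x \<in> hset H \<Longrightarrow> y \<in> hset H \<Longrightarrow> hinner H (hact H x a) y = star a * hinner H x y"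
  using inner_act[of y x a] by (metis act_closed star_mult star_inner)

lemma act_minus: "x \<in> hset H \<Longrightarrow> hact H (- x) a = - hact H x a"
proof -
  assume x: "x \<in> hset H"
  have "hact H 0 a = 0" using act_add[of 0 0 a] by simp
  then show ?thesis using act_add[of x "-x" a] x by (simp add: eq_neg_iff_add_eq_0 add.commute)
qed

lemma hnorm_square: "(hnorm H x)\<^sup>2 = norm (hinner H x x)"
  by (simp add: hnorm_def)

text \<open>Cauchy-Schwarz by completing the square:
  \<open>hinner H y y - (1 / N) *\<^sub>R (star a * a)\<close> is positive for every
  \<open>N\<close> above the squared norm of \<open>x\<close>. A strictly larger \<open>N\<close>
  can be divided by even if \<open>x\<close> has norm 0; the limit in \<open>N\<close> removes the
  slack.\<close>

lemma norm_inner_le: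
  assumes x: "x \<in> hset H" and y: "y \<in> hset H"
  shows "norm (hinner H x y) \<le> hnorm H x * hnorm H y"
proof -
  define a where "a = hinner H x y"
  have le: "(norm a)\<^sup>2 \<le> N * (hnorm H y)\<^sup>2" if N: "N > (hnorm H x)\<^sup>2" for N
  proof -
    have N0: "N > 0" using N zero_le_power2[of "hnorm H x"] by linarith
    define b where "b = - (1 / N) *\<^sub>R a"
    have sa: "hinner H y x = star a" using x y by (simp add: a_def star_inner)
    have "hinner H (y + hact H x b) (y + hact H x b) =
        hinner H y y + star a * b + star b * a + star b * hinner H x x * b"
      using x y by (simp add: inner_add inner_add_left inner_act inner_act_left sa algebra_simps flip: a_def)
    then have 1: "cpos (hinner H y y + star a * b + star b * a + star b * hinner H x x * b)"
      using inner_pos[of "y + hact H x b"] x y by simp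
    \<comment> \<open>Adding this slack, conjugated by \<open>b\<close>, replaces
      \<open>hinner H x x\<close> by the scalar \<open>N\<close>; for that expression
      \<open>b\<close> is the minimiser.\<close>
    have "cpos (N *\<^sub>R 1 - hinner H x x)"
      using x N by (intro cpos_sub_scalar) (auto simp: star_inner hnorm_square)
    then have "cpos (star b * (N *\<^sub>R 1 - hinner H x x) * b)" by (rule cpos_conj)
    from cpos_add[OF 1 this]
    have "cpos (hinner H y y + star a * b + star b * a + N *\<^sub>R (star b * b))"
      by (simp add: algebra_simps)
    also have "hinner H y y + star a * b + star b * a + N *\<^sub>R (star b * b) =
        hinner H y y - (1 / N) *\<^sub>R (star a * a)"
      using N0 by (simp add: b_def)
    finally have "norm ((1 / N) *\<^sub>R (star a * a)) \<le> norm (hinner H y y)"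
      using N0 by (intro norm_mono_cpos cpos_scaleR cpos_star_mult_self) auto
    then show ?thesis using N0 by (simp add: norm_star_mult_self hnorm_square field_simps)
  qed
  have "(norm a)\<^sup>2 \<le> (hnorm H x)\<^sup>2 * (hnorm H y)\<^sup>2"
  proof (rule LIMSEQ_le_const)
    show "(\<lambda>n. ((hnorm H x)\<^sup>2 + inverse (real (Suc n))) * (hnorm H y)\<^sup>2) \<longlonglongrightarrow>
        (hnorm H x)\<^sup>2 * (hnorm H y)\<^sup>2"
      by (rule tendsto_eq_intros LIMSEQ_inverse_real_of_nat_add tendsto_const refl)+
  qed (use le in \<open>auto intro!: exI[of _ 0]\<close>)
  then show ?thesis
    unfolding a_def by (metis abs_le_square_iff abs_norm_cancel abs_of_nonneg hnorm_nonneg mult_nonneg_nonneg power_mult_distrib)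
qed

lemma hnorm_triangle:
  assumes "x \<in> hset H" "y \<in> hset H"
  shows "hnorm H (x + y) \<le> hnorm H x + hnorm H y"
proof (rule power2_le_imp_le)
  have "(hnorm H (x + y))\<^sup>2 \<le> norm (hinner H x x) + norm (hinner H x y) + norm (hinner H y x) + norm (hinner H y y)"
    unfolding hnorm_square using assms
    by (simp add: inner_add inner_add_left)
       (smt (verit) norm_triangle_ineq add.assoc)
  also have "\<dots> \<le> (hnorm H x + hnorm H y)\<^sup>2"
    using norm_inner_le[of x y] norm_inner_le[of y x] assms
    by (simp add: power2_sum hnorm_square algebra_simps)
  finally show "(hnorm H (x + y))\<^sup>2 \<le> (hnorm H x + hnorm H y)\<^sup>2" .
qed simp

lemma hnorm_0 [simp]: "hnorm H 0 = 0"
  using inner_add[of 0 0 0] by (simp add: hnorm_def)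

lemma hnorm_act: "x \<in> hset H \<Longrightarrow> hnorm H (hact H x a) \<le> hnorm H x * norm a"
proof (rule power2_le_imp_le)
  assume x: "x \<in> hset H"
  have "norm (star a * (hinner H x x * a)) \<le> norm a * (norm (hinner H x x) * norm a)"
    by (intro order_trans[OF norm_mult_ineq] mult_mono) (auto simp: norm_star norm_mult_ineq)
  then show "(hnorm H (hact H x a))\<^sup>2 \<le> (hnorm H x * norm a)\<^sup>2"
    using x by (simp add: hnorm_square inner_act inner_act_left power_mult_distrib mult.assoc)
      (simp add: power2_eq_square algebra_simps)
qed simp

lemma hnorm_scaleC: "x \<in> hset H \<Longrightarrow> hnorm H (c *\<^sub>C x) = cmod c * hnorm H x"
proof -
  assume x: "x \<in> hset H"
  have "hinner H (c *\<^sub>C x) (c *\<^sub>C x) = c *\<^sub>C cnj c *\<^sub>C hinner H x x"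
    using x inner_scaleC[of "c *\<^sub>C x" x c] inner_scaleC[of x x c]
    by (metis scaleC_closed star_inner star_scaleC)
  then show ?thesis by (simp add: hnorm_def norm_scaleC real_sqrt_mult)
qed

lemma hnorm_minus: "x \<in> hset H \<Longrightarrow> hnorm H (- x) = hnorm H x"
  using hnorm_scaleC[of x "-1"] by (simp add: scaleC_minus1)

lemma hnorm_minus_commute: "x \<in> hset H \<Longrightarrow> y \<in> hset H \<Longrightarrow> hnorm H (x - y) = hnorm H (y - x)"
  using hnorm_minus[of "x - y"] by simp

lemma hnorm_triangle_diff:
  "x \<in> hset H \<Longrightarrow> y \<in> hset H \<Longrightarrow> z \<in> hset H \<Longrightarrow> hnorm H (x - z) \<le> hnorm H (x - y) + hnorm H (y - z)"
  using hnorm_triangle[of "x - y" "y - z"] by simp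

lemma hnorm_diff_le: "x \<in> hset H \<Longrightarrow> y \<in> hset H \<Longrightarrow> hnorm H (x - y) \<le> hnorm H x + hnorm H y"
  using hnorm_triangle[of x "- y"] by (simp add: hnorm_minus)

lemma hnorm_sum: "(\<And>i. i \<in> I \<Longrightarrow> f i \<in> hset H) \<Longrightarrow> hnorm H (sum f I) \<le> (\<Sum>i\<in>I. hnorm H (f i))"
  by (induction I rule: infinite_finite_induct)
     (auto intro: order_trans[OF hnorm_triangle] add_left_mono)

lemma lim_add:
  assumes "\<And>n. s n \<in> hset H" "\<And>n. t n \<in> hset H" "x \<in> hset H" "y \<in> hset H"
    and "(\<lambda>n. hnorm H (s n - x)) \<longlonglongrightarrow> 0" "(\<lambda>n. hnorm H (t n - y)) \<longlonglongrightarrow> 0"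
  shows "(\<lambda>n. hnorm H ((s n + t n) - (x + y))) \<longlonglongrightarrow> 0"
proof (rule Lim_null_comparison[OF always_eventually])
  show "(\<lambda>n. hnorm H (s n - x) + hnorm H (t n - y)) \<longlonglongrightarrow> 0"
    using tendsto_add[OF assms(5,6)] by simp
  show "\<forall>n. norm (hnorm H ((s n + t n) - (x + y))) \<le> hnorm H (s n - x) + hnorm H (t n - y)"
    using hnorm_triangle[OF diff_closed[OF assms(1,3)] diff_closed[OF assms(2,4)]]
    by (simp add: algebra_simps)
qed

lemma lim_diff:
  assumes "\<And>n. s n \<in> hset H" "\<And>n. t n \<in> hset H" "x \<in> hset H" "y \<in> hset H"
    and "(\<lambda>n. hnorm H (s n - x)) \<longlonglongrightarrow> 0" "(\<lambda>n. hnorm H (t n - y)) \<longlonglongrightarrow> 0"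
  shows "(\<lambda>n. hnorm H ((s n - t n) - (x - y))) \<longlonglongrightarrow> 0"
  using lim_add[of s "\<lambda>n. - t n" x "- y"] assms hnorm_minus[of "t _ - y"] by (simp add: algebra_simps)

lemma lim_hnorm_le:
  assumes "\<And>n. s n \<in> hset H" "x \<in> hset H" "(\<lambda>n. hnorm H (s n - x)) \<longlonglongrightarrow> 0"
    and "\<And>n. hnorm H (s n) \<le> R"
  shows "hnorm H x \<le> R"
proof (rule LIMSEQ_le_const)
  show "(\<lambda>n. hnorm H (s n - x) + R) \<longlonglongrightarrow> R" using tendsto_add[OF assms(3) tendsto_const[of R]] by simp
  have "hnorm H x \<le> hnorm H (s n - x) + R" for n
    using hnorm_triangle[of "x - s n" "s n"] assms hnorm_minus_commute[of x "s n"] by (smt (verit) diff_add_cancel diff_closed)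
  then show "\<exists>N. \<forall>n\<ge>N. hnorm H x \<le> hnorm H (s n - x) + R" by blast
qed

lemma semi_inner_module_restrict:
  assumes "submodule H M"
  shows "semi_inner_module (H \<restriction>\<^sub>h M)"
proof -
  have M: "M \<subseteq> hset H" and sub: "submodule (H \<restriction>\<^sub>h M) M" using assms by (auto simp: submodule_def)
  show ?thesis
    using M[THEN subsetD] sub
    by unfold_locales
       (auto simp: act_add act_add_right inner_add inner_act star_inner inner_pos simp flip: scaleC_eq_act)
qed

end

section \<open>Complete modules and the open mapping theorem\<close>

locale hilbert_module = semi_inner_module +
  assumes inner_definite: "x \<in> hset H \<Longrightarrow> hinner H x x = 0 \<Longrightarrow> x = 0"
    and complete: "(\<And>n. s n \<in> hset H) \<Longrightarrow>
      (\<And>e. e > 0 \<Longrightarrow> \<exists>N. \<forall>m\<ge>N. \<forall>n\<ge>N. hnorm H (s m - s n) < e) \<Longrightarrow>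
      \<exists>x\<in>hset H. (\<lambda>n. hnorm H (s n - x)) \<longlonglongrightarrow> 0"
begin

lemma hnorm_eq_0: "x \<in> hset H \<Longrightarrow> hnorm H x = 0 \<longleftrightarrow> x = 0"
  using inner_definite[of x] hnorm_0 by (auto simp: hnorm_def)

lemma lim_unique:
  assumes "\<And>n. s n \<in> hset H" "x \<in> hset H" "y \<in> hset H"
    and "(\<lambda>n. hnorm H (s n - x)) \<longlonglongrightarrow> 0" "(\<lambda>n. hnorm H (s n - y)) \<longlonglongrightarrow> 0"
  shows "x = y"
proof -
  have "(\<lambda>n. hnorm H (x - y)) \<longlonglongrightarrow> 0"
    using lim_diff[OF assms(1,1,3,2,5,4)] by simp
  then have "hnorm H (x - y) = 0" by (simp add: LIMSEQ_const_iff)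
  then show ?thesis using assms by (simp add: hnorm_eq_0)
qed

lemma absolutely_convergent:
  assumes f: "\<And>n. f n \<in> hset H" "\<And>n. hnorm H (f n) \<le> r n" and r: "r sums R"
  obtains x where "x \<in> hset H" "(\<lambda>n. hnorm H ((\<Sum>k<n. f k) - x)) \<longlonglongrightarrow> 0" "hnorm H x \<le> R"
proof -
  have r0: "0 \<le> r n" for n by (rule order_trans[OF hnorm_nonneg f(2)])
  have "\<exists>N. \<forall>m\<ge>N. \<forall>n\<ge>N. hnorm H ((\<Sum>k<m. f k) - (\<Sum>k<n. f k)) < e" if e: "e > 0" for e
  proof -
    obtain N where N: "\<And>m n. m \<ge> N \<Longrightarrow> norm (sum r {m..<n}) < e"
      using sums_summable[OF r] e unfolding summable_Cauchy by metis
    have le: "hnorm H ((\<Sum>k<n. f k) - (\<Sum>k<m. f k)) < e" if "m \<ge> N" "m \<le> n" for m n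
    proof -
      have "(\<Sum>k<n. f k) - (\<Sum>k<m. f k) = sum f {m..<n}"
        using that by (simp add: atLeast0LessThan[symmetric] sum_diff_nat_ivl)
      also have "hnorm H \<dots> \<le> sum r {m..<n}"
        by (rule order_trans[OF hnorm_sum sum_mono]) (use f in auto)
      also have "\<dots> < e" using N[OF that(1), of n] by simp
      finally show ?thesis .
    qed
    have "hnorm H ((\<Sum>k<m. f k) - (\<Sum>k<n. f k)) < e" if "m \<ge> N" "n \<ge> N" for m n
      using le[of m n] le[of n m] that hnorm_minus_commute[of "\<Sum>k<m. f k" "\<Sum>k<n. f k"] f
      by (cases "m \<le> n") auto
    then show ?thesis by blast
  qed
  then obtain x where x: "x \<in> hset H" "(\<lambda>n. hnorm H ((\<Sum>k<n. f k) - x)) \<longlonglongrightarrow> 0"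
    using complete[of "\<lambda>n. \<Sum>k<n. f k"] f by auto
  have "hnorm H (\<Sum>k<n. f k) \<le> R" for n
  proof -
    have "hnorm H (\<Sum>k<n. f k) \<le> (\<Sum>k<n. r k)"
      by (rule order_trans[OF hnorm_sum sum_mono]) (use f in auto)
    also have "\<dots> \<le> R" using r r0 by (metis sum_le_suminf sums_iff finite_lessThan)
    finally show ?thesis .
  qed
  then have "hnorm H x \<le> R" using f by (intro lim_hnorm_le[OF _ x]) auto
  then show thesis using x that by blast
qed

lemma hilbert_module_restrict:
  assumes "closed_submodule H M"
  shows "hilbert_module (H \<restriction>\<^sub>h M)"
proof -
  have M: "M \<subseteq> hset H" "submodule H M"
    using assms by (auto simp: closed_submodule_def submodule_def)
  interpret M: semi_inner_module "H \<restriction>\<^sub>h M" by (rule semi_inner_module_restrict) fact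
  show ?thesis
  proof
    fix s :: "nat \<Rightarrow> 'b" assume s: "\<And>n. s n \<in> hset (H \<restriction>\<^sub>h M)"
      "\<And>e. e > 0 \<Longrightarrow> \<exists>N. \<forall>m\<ge>N. \<forall>n\<ge>N. hnorm (H \<restriction>\<^sub>h M) (s m - s n) < e"
    have "s n \<in> hset H" for n using s(1) M(1) by auto
    then obtain x where "x \<in> hset H" "(\<lambda>n. hnorm H (s n - x)) \<longlonglongrightarrow> 0"
      using complete[of s] s(2) unfolding hnorm_restrict by blast
    moreover from this have "x \<in> M"
      using closed_submodule_limit[OF assms, of s x] s(1) by simp
    ultimately show "\<exists>x\<in>hset (H \<restriction>\<^sub>h M). (\<lambda>n. hnorm (H \<restriction>\<^sub>h M) (s n - x)) \<longlonglongrightarrow> 0"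
      by auto
  qed (use M inner_definite in auto)
qed

text \<open>The value 0 off the carrier provides the symmetry that \<^locale>\<open>Metric_space\<close> demands at all points.\<close>

definition hdist :: "'b \<Rightarrow> 'b \<Rightarrow> real"
  where "hdist x y = (if x \<in> hset H \<and> y \<in> hset H then hnorm H (x - y) else 0)"

lemma hdist_eq [simp]: "x \<in> hset H \<Longrightarrow> y \<in> hset H \<Longrightarrow> hdist x y = hnorm H (x - y)"
  by (simp add: hdist_def)

sublocale hmetric: Metric_space "hset H" hdist
proof
  show "hdist x y = hdist y x" for x y by (simp add: hdist_def hnorm_minus_commute)
qed (auto simp: hdist_def hnorm_eq_0 hnorm_triangle_diff)

lemma hmetric_complete: "hmetric.mcomplete"
  unfolding hmetric.mcomplete_def
proof (intro allI impI)
  fix s assume s: "hmetric.MCauchy s"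
  then have mem: "s n \<in> hset H" for n by (auto simp: hmetric.MCauchy_def)
  have "\<exists>N. \<forall>m\<ge>N. \<forall>n\<ge>N. hnorm H (s m - s n) < e" if e: "e > 0" for e
  proof -
    obtain N where "\<And>n n'. N \<le> n \<Longrightarrow> N \<le> n' \<Longrightarrow> hdist (s n) (s n') < e"
      using s e unfolding hmetric.MCauchy_def by blast
    then show ?thesis using mem by auto
  qed
  then obtain x where "x \<in> hset H" "(\<lambda>n. hnorm H (s n - x)) \<longlonglongrightarrow> 0"
    using complete[of s] mem by blast
  then show "\<exists>x. limitin hmetric.mtopology s x sequentially"
    unfolding hmetric.limitin_metric_dist_null using mem by (intro exI[of _ x]) simp
qed

text \<open>\<open>T x = y\<close> is the fixed point equation of the map sending \<open>x\<close>
  to \<open>y + (x - T x)\<close>, a contraction with factor 1/2.\<close>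

lemma surj_if_near_id:
  assumes T: "T ` hset H \<subseteq> hset H" "\<And>x y. x \<in> hset H \<Longrightarrow> y \<in> hset H \<Longrightarrow> T (x - y) = T x - T y"
    and near: "\<And>x. x \<in> hset H \<Longrightarrow> hnorm H (x - T x) \<le> hnorm H x / 2"
    and y: "y \<in> hset H"
  obtains x where "x \<in> hset H" "T x = y"
proof -
  obtain x where "x \<in> hset H" "y + (x - T x) = x"
  proof (rule hmetric.Banach_fixedpoint_thm[OF hmetric_complete])
    fix u v assume uv: "u \<in> hset H" "v \<in> hset H"
    have "(y + (u - T u)) - (y + (v - T v)) = (u - v) - T (u - v)"
      using T(2)[OF uv] by simp
    moreover have "y + (u - T u) \<in> hset H" "y + (v - T v) \<in> hset H"
      using uv T(1) y by auto
    ultimately show "hdist (y + (u - T u)) (y + (v - T v)) \<le> (1/2) * hdist u v"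
      using near[of "u - v"] uv by (simp only: hdist_eq diff_closed) simp
  qed (use T(1) y in auto)
  then show thesis using that[of x] by (simp add: algebra_simps)
qed

text \<open>The open mapping theorem. The set \<open>A r\<close> stands for the image of the ball of radius \<open>r\<close>; the
  last hypothesis expresses completeness of the domain.\<close>

lemma bounded_gauge:
  fixes A :: "real \<Rightarrow> 'b set"
  assumes cover: "\<And>x. x \<in> hset H \<Longrightarrow> \<exists>r. x \<in> A r"
    and sub: "\<And>r. A r \<subseteq> hset H"
    and mono: "\<And>r s. r \<le> s \<Longrightarrow> A r \<subseteq> A s"
    and diff: "\<And>x y r s. x \<in> A r \<Longrightarrow> y \<in> A s \<Longrightarrow> x - y \<in> A (r + s)"
    and scale: "\<And>x r c. x \<in> A r \<Longrightarrow> 0 \<le> c \<Longrightarrow> complex_of_real c *\<^sub>C x \<in> A (c * r)"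
    and series: "\<And>f r R x. (\<And>n. f n \<in> A (r n)) \<Longrightarrow> r sums R \<Longrightarrow> x \<in> hset H \<Longrightarrow>
      (\<lambda>n. hnorm H ((\<Sum>k<n. f k) - x)) \<longlonglongrightarrow> 0 \<Longrightarrow> x \<in> A R"
  obtains C where "0 < C" "\<And>x. x \<in> hset H \<Longrightarrow> x \<in> A (C * hnorm H x)"
proof -
  let ?cl = "\<lambda>n::nat. hmetric.mtopology closure_of A (real n)"
  have "\<Union>(range ?cl) = hset H"
  proof (intro equalityI subsetI)
    fix x assume x: "x \<in> hset H"
    then obtain r where "x \<in> A r" using cover by blast
    then have "x \<in> A (real (nat \<lceil>r\<rceil>))" using mono[of r "real (nat \<lceil>r\<rceil>)"] real_nat_ceiling_ge by blast
    then have "x \<in> ?cl (nat \<lceil>r\<rceil>)" using closure_of_subset[of "A (real (nat \<lceil>r\<rceil>))" hmetric.mtopology] sub by auto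
    then show "x \<in> \<Union>(range ?cl)" by blast
  qed (use closure_of_subset_topspace[of hmetric.mtopology] in fastforce)
  \<comment> \<open>The countably many closures fill a nonempty complete space, so by Baire's
    theorem one of them contains a ball.\<close>
  then have "hmetric.mtopology interior_of \<Union>(range ?cl) \<noteq> {}"
    using zero_closed interior_of_topspace[of hmetric.mtopology] by (metis empty_iff hmetric.topspace_mtopology)
  then obtain n y0 where "y0 \<in> hmetric.mtopology interior_of ?cl n"
    using hmetric.metric_Baire_category_alt[OF hmetric_complete, of "range ?cl"] by fastforce
  then obtain \<rho> where \<rho>: "\<rho> > 0" and y0: "y0 \<in> hset H" "hmetric.mball y0 \<rho> \<subseteq> ?cl n"
    using hmetric.in_interior_of_mball by blast
  \<comment> \<open>The added 1 makes \<open>N\<close>, and through it the final constant, positive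
    even if Baire yields \<open>n = 0\<close>.\<close>
  define N where "N = real n + 1"
  have N0: "N > 0" by (simp add: N_def)
  have near: "\<exists>a\<in>A N. hnorm H (y - a) < e" if y: "y \<in> hset H" "hnorm H (y0 - y) < \<rho>" "e > 0" for y e
  proof -
    have "y \<in> ?cl n" using y y0 by auto
    then obtain a where "a \<in> A (real n)" "a \<in> hmetric.mball y e"
      using y(3) unfolding hmetric.metric_closure_of by auto
    then show ?thesis using mono[of "real n" N] by (auto simp: N_def intro!: bexI[of _ a])
  qed
  \<comment> \<open>A point near 0 is the difference of \<open>y0 + x\<close> and \<open>y0\<close>,
    both in the ball; this moves the ball to the origin and doubles the radius to
    \<open>2 * N\<close>.\<close>
  have approx1: "\<exists>z\<in>A (2 * N). hnorm H (x - z) < e" if x: "x \<in> hset H" "hnorm H x < \<rho>" "e > 0" for x e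
  proof -
    obtain a where a: "a \<in> A N" "hnorm H (y0 - a) < e / 2" using near[of y0 "e/2"] y0 \<rho> x by auto
    obtain b where b: "b \<in> A N" "hnorm H (y0 + x - b) < e / 2"
      using near[of "y0 + x" "e/2"] y0 x by (auto simp: hnorm_minus)
    have "x - (b - a) = (y0 + x - b) - (y0 - a)" by simp
    also have "hnorm H \<dots> \<le> hnorm H (y0 + x - b) + hnorm H (y0 - a)"
      using a b sub x y0 by (intro hnorm_diff_le) auto
    also have "\<dots> < e" using a b by simp
    finally show ?thesis using diff[OF b(1) a(1)] by auto
  qed
  have approx: "\<exists>z\<in>A (2 * N * t). hnorm H (x - z) < e"
    if x: "x \<in> hset H" "hnorm H x < \<rho> * t" and e: "e > 0" and t: "t > 0" for x e t
  proof -
    define x' where "x' = complex_of_real (1 / t) *\<^sub>C x"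
    have "hnorm H x' < \<rho>" using that by (simp add: x'_def hnorm_scaleC norm_divide field_simps)
    then obtain z where z: "z \<in> A (2 * N)" "hnorm H (x' - z) < e / t"
      using approx1[of x' "e / t"] x e t by (auto simp: x'_def)
    have "complex_of_real t *\<^sub>C x' = x"
      using that by (simp add: x'_def scaleC_scaleC scaleC_one)
    then have "x - complex_of_real t *\<^sub>C z = complex_of_real t *\<^sub>C (x' - z)"
      using scaleC_add_right[of t x' "-z"] by (simp add: scaleC_minus_right)
    then have "hnorm H (x - complex_of_real t *\<^sub>C z) < e"
      using z that sub by (simp add: hnorm_scaleC x'_def subset_iff pos_less_divide_eq mult.commute)
    then show ?thesis using scale[OF z(1), of t] that by (auto simp: mult.commute)
  qed
  \<comment> \<open>Iterated approximation removes the closure: the remainders \<open>g n\<close>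
    shrink like \<open>(1/2) ^ n\<close>, and the radii \<open>2 * N * (1/2) ^ n\<close> add up to
    \<open>4 * N\<close>.\<close>
  have ball: "x \<in> A (4 * N)" if x: "x \<in> hset H" "hnorm H x < \<rho>" for x
  proof -
    have "\<exists>g. g 0 = x \<and> (\<forall>n. g n \<in> hset H \<and> hnorm H (g n) < \<rho> * (1/2) ^ n) \<and>
        (\<forall>n. g n - g (Suc n) \<in> A (2 * N * (1/2) ^ n))"
    proof -
      have "\<exists>g. \<forall>n. (g n \<in> hset H \<and> hnorm H (g n) < \<rho> * (1/2) ^ n \<and> (n = 0 \<longrightarrow> g n = x)) \<and>
          g n - g (Suc n) \<in> A (2 * N * (1/2) ^ n)"
      proof (rule dependent_nat_choice)
        fix g n assume g: "g \<in> hset H \<and> hnorm H g < \<rho> * (1/2) ^ n \<and> (n = 0 \<longrightarrow> g = x)"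
        then obtain z where "z \<in> A (2 * N * (1/2) ^ n)" "hnorm H (g - z) < \<rho> * (1/2) ^ Suc n"
          using approx[of g "(1/2) ^ n" "\<rho> * (1/2) ^ Suc n"] \<rho> by auto
        then show "\<exists>h. (h \<in> hset H \<and> hnorm H h < \<rho> * (1/2) ^ Suc n \<and> (Suc n = 0 \<longrightarrow> h = x)) \<and>
            g - h \<in> A (2 * N * (1/2) ^ n)"
          using g sub by (intro exI[of _ "g - z"]) auto
      qed (use x in auto)
      then show ?thesis by blast
    qed
    then obtain g where g: "g 0 = x" "\<And>n. g n \<in> hset H" "\<And>n. hnorm H (g n) < \<rho> * (1/2) ^ n"
        "\<And>n. g n - g (Suc n) \<in> A (2 * N * (1/2) ^ n)" by blast
    show ?thesis
    proof (rule series[OF g(4)])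
      show "(\<lambda>n. 2 * N * (1/2) ^ n) sums (4 * N)"
        using sums_mult[OF geometric_sums[of "1/2::real"], of "2 * N"] by simp
      have "(\<Sum>k<n. g k - g (Suc k)) - x = - g n" for n
        by (simp add: sum_lessThan_telescope' g(1))
      then have eq: "hnorm H ((\<Sum>k<n. g k - g (Suc k)) - x) = hnorm H (g n)" for n
        by (simp add: hnorm_minus g)
      show "(\<lambda>n. hnorm H ((\<Sum>k<n. g k - g (Suc k)) - x)) \<longlonglongrightarrow> 0"
        unfolding eq
      proof (rule Lim_null_comparison[OF always_eventually])
        show "(\<lambda>n. \<rho> * (1/2) ^ n) \<longlonglongrightarrow> 0"
          by (rule tendsto_mult_right_zero) (simp add: LIMSEQ_realpow_zero)
      qed (use g(3) less_imp_le in auto)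
    qed fact
  qed
  show thesis
  proof (rule that[of "8 * N / \<rho>"])
    fix x assume x: "x \<in> hset H"
    show "x \<in> A (8 * N / \<rho> * hnorm H x)"
    proof (cases "x = 0")
      case True
      have "complex_of_real 0 *\<^sub>C (0::'b) \<in> A (0 * (4 * N))"
        using ball[of 0] \<rho> by (intro scale) auto
      then show ?thesis using True scaleC_add_left[of 0 0 "0::'b"] by simp
    next
      case False
      \<comment> \<open>Division by \<open>c\<close> brings \<open>x\<close> to norm
        \<open>\<rho> / 2\<close>, inside the open ball; \<open>c * (4 * N)\<close> is then
        \<open>8 * N / \<rho>\<close> times the norm of \<open>x\<close>.\<close>
      define c where "c = 2 * hnorm H x / \<rho>"
      have hx: "hnorm H x > 0" using x False hnorm_eq_0[of x] hnorm_nonneg[of H x] by linarith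
      then have c: "c > 0" using \<rho> by (simp add: c_def)
      have "complex_of_real (1 / c) *\<^sub>C x \<in> A (4 * N)"
        using x hx \<rho> c by (intro ball) (auto simp: hnorm_scaleC norm_divide c_def)
      then have "complex_of_real c *\<^sub>C complex_of_real (1 / c) *\<^sub>C x \<in> A (c * (4 * N))"
        using c by (intro scale) auto
      then show ?thesis using c by (simp add: scaleC_scaleC scaleC_one) (simp add: c_def mult_ac)
    qed
  qed (use \<rho> N0 in auto)
qed

end

section \<open>The standard module\<close>

definition trunc_hmod :: "nat set \<Rightarrow> ('a::unital_cstar_algebra, nat \<Rightarrow> 'a) hmod"
  where "trunc_hmod I = \<lparr>hset = UNIV, hact = (\<lambda>x a n. x n * a), hinner = (\<lambda>x y. \<Sum>n\<in>I. star (x n) * y n)\<rparr>"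

lemma trunc_hmod_simps [simp]:
  "hset (trunc_hmod I) = UNIV"
  "hact (trunc_hmod I) x a = (\<lambda>n. x n * a)"
  "hinner (trunc_hmod I) x y = (\<Sum>n\<in>I. star (x n) * y n)"
  by (simp_all add: trunc_hmod_def)

interpretation trunc: semi_inner_module "trunc_hmod I"
  by unfold_locales
     (auto simp: submodule_def fun_eq_iff scaleC_fun_def mult_scaleC_right distrib_left distrib_right
       sum.distrib sum_distrib_right mult.assoc star_sum star_mult star_star intro!: cpos_sum cpos_star_mult_self)

lemma hnorm_trunc_mono:
  assumes "finite J" "I \<subseteq> J"
  shows "hnorm (trunc_hmod I) x \<le> hnorm (trunc_hmod J) x"
proof -
  have "(\<Sum>n\<in>J. star (x n) * x n) - (\<Sum>n\<in>I. star (x n) * x n) = (\<Sum>n\<in>J - I. star (x n) * x n)"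
    using assms by (simp add: sum_diff)
  then have "norm (\<Sum>n\<in>I. star (x n) * x n) \<le> norm (\<Sum>n\<in>J. star (x n) * x n)"
    by (intro norm_mono_cpos) (auto intro: cpos_sum cpos_star_mult_self)
  then show ?thesis by (simp add: hnorm_def)
qed

lemma hnorm_trunc_singleton [simp]: "hnorm (trunc_hmod {n}) x = norm (x n)"
  by (simp add: hnorm_def norm_star_mult_self)

lemma std_hmod_simps [simp]:
  "x \<in> hset H\<^sub>A \<longleftrightarrow> summable (\<lambda>n. star (x n) * x n)"
  "hact H\<^sub>A x a = (\<lambda>n. x n * a)"
  "hinner H\<^sub>A x y = (\<Sum>n. star (x n) * y n)"
  by (simp_all add: std_hmod_def)

text \<open>Membership is norm convergence of the series of squares, not of the squared norms, so it
  has to be tested by seminorms of whole blocks rather than coordinate by coordinate.\<close>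

lemma std_iff_Cauchy:
  "summable (\<lambda>n. star (x n) * x n) \<longleftrightarrow> (\<forall>e>0. \<exists>N. \<forall>m\<ge>N. \<forall>n. hnorm (trunc_hmod {m..<n}) x < e)"
proof
  assume *: "summable (\<lambda>n. star (x n) * x n)"
  show "\<forall>e>0. \<exists>N. \<forall>m\<ge>N. \<forall>n. hnorm (trunc_hmod {m..<n}) x < e"
  proof (intro allI impI)
    fix e :: real assume e: "e > 0"
    then obtain N where "\<forall>m\<ge>N. \<forall>n. norm (\<Sum>n\<in>{m..<n}. star (x n) * x n) < e\<^sup>2"
      using * unfolding summable_Cauchy by (meson zero_less_power)
    then show "\<exists>N. \<forall>m\<ge>N. \<forall>n. hnorm (trunc_hmod {m..<n}) x < e"
      using e by (auto simp: hnorm_def real_sqrt_less_iff intro!: exI[of _ N] real_less_lsqrt)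
  qed
next
  assume *: "\<forall>e>0. \<exists>N. \<forall>m\<ge>N. \<forall>n. hnorm (trunc_hmod {m..<n}) x < e"
  show "summable (\<lambda>n. star (x n) * x n)"
    unfolding summable_Cauchy
  proof (intro allI impI)
    fix e :: real assume "e > 0"
    then obtain N where "\<forall>m\<ge>N. \<forall>n. hnorm (trunc_hmod {m..<n}) x < sqrt e"
      using * by (meson real_sqrt_gt_zero)
    then show "\<exists>N. \<forall>m\<ge>N. \<forall>n. norm (\<Sum>n\<in>{m..<n}. star (x n) * x n) < e"
      by (auto simp: hnorm_def intro!: exI[of _ N])
  qed
qed

text \<open>Cauchy-Schwarz on blocks: one factor is eventually below 1, the other arbitrarily
  small.\<close>

lemma std_summable_inner:
  assumes "summable (\<lambda>n. star (x n) * x n)" "summable (\<lambda>n. star (y n) * y n)"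
  shows "summable (\<lambda>n. star (x n) * y n)"
  unfolding summable_Cauchy
proof (intro allI impI)
  fix e :: real assume e: "e > 0"
  obtain M where M: "\<forall>m\<ge>M. \<forall>n. hnorm (trunc_hmod {m..<n}) x < 1"
    using assms(1) unfolding std_iff_Cauchy by (meson zero_less_one)
  obtain N where N: "\<forall>m\<ge>N. \<forall>n. hnorm (trunc_hmod {m..<n}) y < e"
    using assms(2) e unfolding std_iff_Cauchy by meson
  have "norm (\<Sum>n\<in>{m..<n}. star (x n) * y n) < e" if "m \<ge> max M N" for m n
  proof -
    have "norm (\<Sum>n\<in>{m..<n}. star (x n) * y n) \<le> hnorm (trunc_hmod {m..<n}) x * hnorm (trunc_hmod {m..<n}) y"
      using trunc.norm_inner_le[of x _ y] by simp
    also have "\<dots> \<le> 1 * hnorm (trunc_hmod {m..<n}) y"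
      using M that by (intro mult_right_mono) (auto simp: less_imp_le)
    also have "\<dots> < e" using N that by simp
    finally show ?thesis .
  qed
  then show "\<exists>N. \<forall>m\<ge>N. \<forall>n. norm (\<Sum>n\<in>{m..<n}. star (x n) * y n) < e" by blast
qed

lemma std_add:
  fixes x y :: "nat \<Rightarrow> 'a::unital_cstar_algebra"
  assumes "summable (\<lambda>n. star (x n) * x n)" "summable (\<lambda>n. star (y n) * y n)"
  shows "summable (\<lambda>n. star (x n + y n) * (x n + y n))"
proof -
  have "summable (\<lambda>n. star (x n) * x n + star (x n) * y n + (star (y n) * x n + star (y n) * y n))"
    by (intro summable_add std_summable_inner[OF assms] std_summable_inner[OF assms(2,1)] assms)
  moreover have "star (a + b) * (a + b) = star a * a + star a * b + (star b * a + star b * b)" for a b :: 'a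
    by (simp add: star_add distrib_left distrib_right)
  ultimately show ?thesis by (simp only:)
qed

lemma std_act:
  assumes "summable (\<lambda>n. star (x n) * x n)"
  shows "summable (\<lambda>n. star (x n * a) * (x n * a))"
  using summable_mult[OF summable_mult2[OF assms, of a], of "star a"] by (simp add: star_mult mult.assoc)

lemma scaleC_eq_mult: "c *\<^sub>C a = a * (c *\<^sub>C (1::'a::unital_cstar_algebra))"
  by (simp add: mult_scaleC_right)

lemma semi_inner_module_std: "semi_inner_module (H\<^sub>A :: ('a::unital_cstar_algebra, nat \<Rightarrow> 'a) hmod)"
proof
  let ?H = "H\<^sub>A :: ('a, nat \<Rightarrow> 'a) hmod"
  show "submodule ?H (hset ?H)"
    unfolding submodule_def
  proof (intro conjI ballI allI)
    fix x :: "nat \<Rightarrow> 'a" and c assume "x \<in> hset H\<^sub>A"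
    then show "c *\<^sub>C x \<in> hset H\<^sub>A"
      using std_act[of x "c *\<^sub>C 1"] by (simp add: scaleC_fun_def flip: scaleC_eq_mult)
  qed (auto intro: std_add std_act)
  show "star (hinner H\<^sub>A x y) = hinner H\<^sub>A y x" if "x \<in> hset H\<^sub>A" "y \<in> hset H\<^sub>A" for x y :: "nat \<Rightarrow> 'a"
    using bounded_linear.suminf[OF bounded_linear_star std_summable_inner[of x y]] that
    by (simp add: star_mult star_star)
  show "cpos (hinner H\<^sub>A x x)" if "x \<in> hset H\<^sub>A" for x :: "nat \<Rightarrow> 'a"
    using that by (auto intro!: cpos_LIMSEQ[OF _ summable_LIMSEQ] cpos_sum cpos_star_mult_self)
qed (auto simp: fun_eq_iff scaleC_fun_def distrib_left distrib_right mult.assoc[symmetric]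
      suminf_add[OF std_summable_inner std_summable_inner] suminf_mult2[OF std_summable_inner]
      mult_scaleC_right)

interpretation std: semi_inner_module H\<^sub>A
  by (rule semi_inner_module_std)

lemma hnorm_trunc_le_std:
  assumes "finite I" "x \<in> hset H\<^sub>A"
  shows "hnorm (trunc_hmod I) x \<le> hnorm H\<^sub>A x"
proof -
  let ?f = "\<lambda>n. star (x n) * x n"
  obtain m where m: "I \<subseteq> {..<m}" using assms(1) finite_nat_iff_bounded by blast
  have "(\<lambda>n. norm (sum ?f {..<n + m})) \<longlonglongrightarrow> norm (suminf ?f)"
    using assms by (intro tendsto_norm LIMSEQ_ignore_initial_segment summable_LIMSEQ) simp
  moreover have "norm (sum ?f I) \<le> norm (sum ?f {..<n + m})" for n
  proof -
    have "I \<subseteq> {..<n + m}" using m by (auto dest!: subsetD)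
    from hnorm_trunc_mono[OF _ this, of x] show ?thesis by (simp add: hnorm_def)
  qed
  ultimately have "norm (sum ?f I) \<le> norm (suminf ?f)"
    by (intro LIMSEQ_le_const) auto
  then show ?thesis by (simp add: hnorm_def)
qed

lemma hnorm_std_le:
  assumes x: "x \<in> hset H\<^sub>A" and le: "\<And>n. hnorm (trunc_hmod {..<n}) x \<le> R"
  shows "hnorm H\<^sub>A x \<le> R"
proof (rule LIMSEQ_le_const2)
  show "(\<lambda>n. hnorm (trunc_hmod {..<n}) x) \<longlonglongrightarrow> hnorm H\<^sub>A x"
    using x unfolding hnorm_def by (auto intro!: tendsto_intros summable_LIMSEQ)
qed (use le in blast)

lemma norm_component_le: "x \<in> hset H\<^sub>A \<Longrightarrow> norm (x n) \<le> hnorm H\<^sub>A x"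
  using hnorm_trunc_le_std[of "{n}" x] by simp

lemma hilbert_module_std: "hilbert_module (H\<^sub>A :: ('a::unital_cstar_algebra, nat \<Rightarrow> 'a) hmod)"
proof
  show "x = 0" if "x \<in> hset H\<^sub>A" "hinner H\<^sub>A x x = 0" for x :: "nat \<Rightarrow> 'a"
    using norm_component_le[OF that(1)] that(2) by (auto simp: hnorm_def fun_eq_iff)
  fix s :: "nat \<Rightarrow> nat \<Rightarrow> 'a"
  assume s: "\<And>n. s n \<in> hset H\<^sub>A"
    and Cauchy: "\<And>e. e > 0 \<Longrightarrow> \<exists>N. \<forall>m\<ge>N. \<forall>n\<ge>N. hnorm H\<^sub>A (s m - s n) < e"
  have "convergent (\<lambda>j. s j k)" for k
  proof (rule Cauchy_convergent, rule metric_CauchyI)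
    fix e :: real assume "e > 0"
    then obtain N where "\<forall>m\<ge>N. \<forall>n\<ge>N. hnorm H\<^sub>A (s m - s n) < e" using Cauchy by blast
    then show "\<exists>M. \<forall>m\<ge>M. \<forall>n\<ge>M. dist (s m k) (s n k) < e"
      using norm_component_le[OF std.diff_closed[OF s s], of _ _ k]
      unfolding dist_norm fun_diff_def by (meson le_less_trans)
  qed
  then obtain x where x: "\<And>k. (\<lambda>j. s j k) \<longlonglongrightarrow> x k"
    unfolding convergent_def by metis
  \<comment> \<open>The estimate is uniform over all finite \<open>I\<close> and precedes the square
    summability of \<open>x\<close>; it yields both membership of the coordinatewise limit and
    convergence in norm.\<close>
  have near: "\<exists>N. \<forall>m\<ge>N. \<forall>I. finite I \<longrightarrow> hnorm (trunc_hmod I) (s m - x) \<le> e" if e: "e > 0" for e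
  proof -
    obtain N where N: "\<forall>m\<ge>N. \<forall>n\<ge>N. hnorm H\<^sub>A (s m - s n) < e" using Cauchy e by blast
    have "hnorm (trunc_hmod I) (s m - x) \<le> e" if "m \<ge> N" "finite I" for m I
    proof (rule LIMSEQ_le_const2)
      show "(\<lambda>n. hnorm (trunc_hmod I) (s m - s n)) \<longlonglongrightarrow> hnorm (trunc_hmod I) (s m - x)"
        by (auto simp: hnorm_def intro!: tendsto_intros tendsto_star x)
      show "\<exists>N. \<forall>n\<ge>N. hnorm (trunc_hmod I) (s m - s n) \<le> e"
        using hnorm_trunc_le_std[OF that(2) std.diff_closed[OF s s]] N that
        by (meson less_imp_le order_trans)
    qed
    then show ?thesis by blast
  qed
  have xin: "x \<in> hset H\<^sub>A"
    unfolding std_hmod_simps std_iff_Cauchy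
  proof (intro allI impI)
    fix e :: real assume e: "e > 0"
    then obtain J where J: "\<And>I. finite I \<Longrightarrow> hnorm (trunc_hmod I) (s J - x) \<le> e / 2"
      using near[of "e / 2"] by auto
    obtain N where N: "\<forall>m\<ge>N. \<forall>n. hnorm (trunc_hmod {m..<n}) (s J) < e / 2"
      using s[of J] e unfolding std_hmod_simps std_iff_Cauchy by (meson half_gt_zero)
    have "hnorm (trunc_hmod {m..<n}) x < e" if "m \<ge> N" for m n
    proof -
      have "hnorm (trunc_hmod {m..<n}) x \<le> hnorm (trunc_hmod {m..<n}) (s J) + hnorm (trunc_hmod {m..<n}) (s J - x)"
        using trunc.hnorm_diff_le[of "s J" "{m..<n}" "s J - x"] by simp
      also have "\<dots> < e" using J[of "{m..<n}"] N that by (metis add_strict_mono add_less_le_mono field_sum_of_halves finite_atLeastLessThan)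
      finally show ?thesis .
    qed
    then show "\<exists>N. \<forall>m\<ge>N. \<forall>n. hnorm (trunc_hmod {m..<n}) x < e" by blast
  qed
  have "(\<lambda>n. hnorm H\<^sub>A (s n - x)) \<longlonglongrightarrow> 0"
  proof (rule metric_LIMSEQ_I)
    fix e :: real assume "e > 0"
    then obtain N where N: "\<forall>m\<ge>N. \<forall>I. finite I \<longrightarrow> hnorm (trunc_hmod I) (s m - x) \<le> e / 2"
      using near[of "e / 2"] by auto
    have "hnorm H\<^sub>A (s m - x) \<le> e / 2" if "m \<ge> N" for m
      by (rule hnorm_std_le[OF std.diff_closed[OF s xin]]) (use N that finite_lessThan in blast)
    then show "\<exists>N. \<forall>n\<ge>N. dist (hnorm H\<^sub>A (s n - x)) 0 < e"
      using \<open>e > 0\<close> by (force simp: dist_real_def intro!: exI[of _ N])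
  qed
  then show "\<exists>x\<in>hset H\<^sub>A. (\<lambda>n. hnorm H\<^sub>A (s n - x)) \<longlonglongrightarrow> 0" using xin by blast
qed

interpretation std: hilbert_module H\<^sub>A
  by (rule hilbert_module_std)

section \<open>Tails of sequences\<close>

definition tail :: "nat \<Rightarrow> (nat \<Rightarrow> 'a::zero) \<Rightarrow> nat \<Rightarrow> 'a"
  where "tail n x = (\<lambda>k. if k < n then 0 else x k)"

lemma hnorm_trunc_tail: "hnorm (trunc_hmod {..<m}) (tail n x) = hnorm (trunc_hmod {n..<m}) x"
proof -
  have "(\<Sum>k<m. star (tail n x k) * tail n x k) = (\<Sum>k\<in>{n..<m}. star (x k) * x k)"
    by (rule sum.mono_neutral_cong_right) (auto simp: tail_def)
  then show ?thesis by (simp add: hnorm_def)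
qed

lemma tail_closed:
  assumes "x \<in> hset H\<^sub>A"
  shows "tail n x \<in> hset H\<^sub>A"
proof -
  have "summable (\<lambda>k. star (tail n x k) * tail n x k) \<longleftrightarrow> summable (\<lambda>k. star (x k) * x k)"
    by (rule summable_cong) (auto simp: tail_def eventually_sequentially intro: exI[of _ n])
  then show ?thesis using assms by simp
qed

lemma hnorm_tail_le: "x \<in> hset H\<^sub>A \<Longrightarrow> hnorm H\<^sub>A (tail n x) \<le> hnorm H\<^sub>A x"
  by (rule hnorm_std_le) (auto simp: hnorm_trunc_tail tail_closed simp del: std_hmod_simps intro: hnorm_trunc_le_std)

text \<open>Convergence is for each \<open>x\<close> separately, with no uniformity over bounded
  sets; it will be applied to the finitely many generators of a module.\<close>

lemma hnorm_tail_LIMSEQ: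
  assumes x: "x \<in> hset H\<^sub>A"
  shows "(\<lambda>n. hnorm H\<^sub>A (tail n x)) \<longlonglongrightarrow> 0"
proof (rule metric_LIMSEQ_I)
  fix e :: real assume e: "e > 0"
  then obtain N where N: "\<forall>m\<ge>N. \<forall>n. hnorm (trunc_hmod {m..<n}) x < e / 2"
    using x unfolding std_hmod_simps std_iff_Cauchy by (meson half_gt_zero)
  have "hnorm H\<^sub>A (tail n x) \<le> e / 2" if "n \<ge> N" for n
    using N that by (intro hnorm_std_le tail_closed x) (simp add: hnorm_trunc_tail less_imp_le)
  then show "\<exists>N. \<forall>n\<ge>N. dist (hnorm H\<^sub>A (tail n x)) 0 < e"
    using e by (force simp: dist_real_def intro!: exI[of _ N])
qed

section \<open>Direct sums\<close>

lemma hsum_simps [simp]: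
  "hset (H \<oplus>\<^sub>h K) = hset H \<times> hset K"
  "hact (H \<oplus>\<^sub>h K) p a = (hact H (fst p) a, hact K (snd p) a)"
  "hinner (H \<oplus>\<^sub>h K) p q = hinner H (fst p) (fst q) + hinner K (snd p) (snd q)"
  by (simp_all add: hsum_def)

lemma semi_inner_module_hsum:
  assumes "semi_inner_module H" "semi_inner_module K"
  shows "semi_inner_module (H \<oplus>\<^sub>h K)"
proof -
  interpret H: semi_inner_module H by fact
  interpret K: semi_inner_module K by fact
  show ?thesis
    by unfold_locales
       (auto simp: submodule_def zero_prod_def scaleC_prod_def H.act_add K.act_add
          H.act_add_right K.act_add_right H.inner_add K.inner_add H.inner_act K.inner_act
          H.star_inner K.star_inner H.scaleC_eq_act K.scaleC_eq_act star_add distrib_right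
          intro!: cpos_add H.inner_pos K.inner_pos)
qed

context
  fixes H :: "('a::unital_cstar_algebra, 'h::complex_vector) hmod"
    and K :: "('a, 'k::complex_vector) hmod"
  assumes H: "semi_inner_module H" and K: "semi_inner_module K"
begin

interpretation H: semi_inner_module H by (rule H)
interpretation K: semi_inner_module K by (rule K)

lemma hnorm_hsum_square_le:
  "p \<in> hset H \<times> hset K \<Longrightarrow> (hnorm (H \<oplus>\<^sub>h K) p)\<^sup>2 \<le> (hnorm H (fst p))\<^sup>2 + (hnorm K (snd p))\<^sup>2"
  by (simp add: hnorm_def norm_triangle_ineq)

lemma hnorm_hsum_le:
  assumes "p \<in> hset H \<times> hset K"
  shows "hnorm (H \<oplus>\<^sub>h K) p \<le> hnorm H (fst p) + hnorm K (snd p)"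
proof (rule power2_le_imp_le)
  have "0 \<le> hnorm H (fst p) * hnorm K (snd p)" by simp
  then show "(hnorm (H \<oplus>\<^sub>h K) p)\<^sup>2 \<le> (hnorm H (fst p) + hnorm K (snd p))\<^sup>2"
    using hnorm_hsum_square_le[OF assms] unfolding power2_sum by linarith
qed simp

lemma hnorm_fst_le: "p \<in> hset H \<times> hset K \<Longrightarrow> hnorm H (fst p) \<le> hnorm (H \<oplus>\<^sub>h K) p"
  unfolding hnorm_def by (auto intro!: norm_mono_cpos H.inner_pos K.inner_pos)

lemma hnorm_snd_le: "p \<in> hset H \<times> hset K \<Longrightarrow> hnorm K (snd p) \<le> hnorm (H \<oplus>\<^sub>h K) p"
  unfolding hnorm_def by (auto intro!: norm_mono_cpos H.inner_pos K.inner_pos)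

end

lemma hilbert_module_hsum:
  fixes H :: "('a::unital_cstar_algebra, 'h::complex_vector) hmod"
    and K :: "('a, 'k::complex_vector) hmod"
  assumes "hilbert_module H" "hilbert_module K"
  shows "hilbert_module (H \<oplus>\<^sub>h K)"
proof -
  interpret H: hilbert_module H by fact
  interpret K: hilbert_module K by fact
  note semi = H.semi_inner_module_axioms K.semi_inner_module_axioms
  interpret semi_inner_module "H \<oplus>\<^sub>h K" by (rule semi_inner_module_hsum[OF semi])
  show ?thesis
  proof
    fix p assume p: "p \<in> hset (H \<oplus>\<^sub>h K)" "hinner (H \<oplus>\<^sub>h K) p p = 0"
    then have "hnorm H (fst p) = 0" "hnorm K (snd p) = 0"
      using hnorm_fst_le[OF semi, of p] hnorm_snd_le[OF semi, of p]
      by (auto simp: hnorm_def[of "H \<oplus>\<^sub>h K"] intro: antisym)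
    then show "p = 0" using p by (auto simp: H.hnorm_eq_0 K.hnorm_eq_0 prod_eq_iff)
  next
    fix s :: "nat \<Rightarrow> 'h \<times> 'k" assume s: "\<And>n. s n \<in> hset (H \<oplus>\<^sub>h K)"
      and Cauchy: "\<And>e. e > 0 \<Longrightarrow> \<exists>N. \<forall>m\<ge>N. \<forall>n\<ge>N. hnorm (H \<oplus>\<^sub>h K) (s m - s n) < e"
    have in_HK: "s n \<in> hset H \<times> hset K" "s m - s n \<in> hset H \<times> hset K" for m n
      using s[of n] diff_closed[OF s s, of m n] by auto
    have "\<exists>x\<in>hset H. (\<lambda>n. hnorm H (fst (s n) - x)) \<longlonglongrightarrow> 0"
    proof (rule H.complete)
      show "\<exists>N. \<forall>m\<ge>N. \<forall>n\<ge>N. hnorm H (fst (s m) - fst (s n)) < e" if "e > 0" for e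
        using Cauchy[OF that] hnorm_fst_le[OF semi in_HK(2)] by (metis fst_diff le_less_trans)
    qed (use in_HK in \<open>auto simp: mem_Times_iff\<close>)
    then obtain x where x: "x \<in> hset H" "(\<lambda>n. hnorm H (fst (s n) - x)) \<longlonglongrightarrow> 0" by blast
    have "\<exists>y\<in>hset K. (\<lambda>n. hnorm K (snd (s n) - y)) \<longlonglongrightarrow> 0"
    proof (rule K.complete)
      show "\<exists>N. \<forall>m\<ge>N. \<forall>n\<ge>N. hnorm K (snd (s m) - snd (s n)) < e" if "e > 0" for e
        using Cauchy[OF that] hnorm_snd_le[OF semi in_HK(2)] by (metis snd_diff le_less_trans)
    qed (use in_HK in \<open>auto simp: mem_Times_iff\<close>)
    then obtain y where y: "y \<in> hset K" "(\<lambda>n. hnorm K (snd (s n) - y)) \<longlonglongrightarrow> 0" by blast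
    have "(\<lambda>n. hnorm (H \<oplus>\<^sub>h K) (s n - (x, y))) \<longlonglongrightarrow> 0"
    proof (rule Lim_null_comparison[OF always_eventually])
      show "(\<lambda>n. hnorm H (fst (s n) - x) + hnorm K (snd (s n) - y)) \<longlonglongrightarrow> 0"
        using tendsto_add[OF x(2) y(2)] by simp
      show "\<forall>n. norm (hnorm (H \<oplus>\<^sub>h K) (s n - (x, y))) \<le> hnorm H (fst (s n) - x) + hnorm K (snd (s n) - y)"
        using hnorm_hsum_le[OF semi, of "s _ - (x, y)"] in_HK(1) x y by (simp add: mem_Times_iff)
    qed
    then show "\<exists>p\<in>hset (H \<oplus>\<^sub>h K). (\<lambda>n. hnorm (H \<oplus>\<^sub>h K) (s n - p)) \<longlonglongrightarrow> 0"
      using x y by (intro bexI[of _ "(x, y)"]) auto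
  qed
qed

interpretation std2: hilbert_module "H\<^sub>A \<oplus>\<^sub>h H\<^sub>A"
  by (rule hilbert_module_hsum[OF hilbert_module_std hilbert_module_std])

section \<open>Module maps and direct decompositions\<close>

context
  fixes H :: "('a::unital_cstar_algebra, 'h::complex_vector) hmod"
    and K :: "('a, 'k::complex_vector) hmod" and T
  assumes T: "bounded_module_map H K T"
begin

lemma bmm_closed: "x \<in> hset H \<Longrightarrow> T x \<in> hset K"
  and bmm_add: "x \<in> hset H \<Longrightarrow> y \<in> hset H \<Longrightarrow> T (x + y) = T x + T y"
  and bmm_scaleC: "x \<in> hset H \<Longrightarrow> T (c *\<^sub>C x) = c *\<^sub>C T x"
  and bmm_act: "x \<in> hset H \<Longrightarrow> T (hact H x a) = hact K (T x) a"
  using T unfolding bounded_module_map_def by auto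

end

lemma bounded_module_map_bound:
  assumes "bounded_module_map H K T"
  obtains B where "0 < B" "\<And>x. x \<in> hset H \<Longrightarrow> hnorm K (T x) \<le> B * hnorm H x"
proof -
  obtain B where B: "\<And>x. x \<in> hset H \<Longrightarrow> hnorm K (T x) \<le> B * hnorm H x"
    using assms unfolding bounded_module_map_def by blast
  have "hnorm K (T x) \<le> (\<bar>B\<bar> + 1) * hnorm H x" if "x \<in> hset H" for x
    by (rule order_trans[OF B[OF that]], rule mult_right_mono) auto
  then show thesis by (intro that[of "\<bar>B\<bar> + 1"]) auto
qed

lemma bounded_module_map_restrict:
  "bounded_module_map H K T \<Longrightarrow> M \<subseteq> hset H \<Longrightarrow> T ` M \<subseteq> N \<Longrightarrow> bounded_module_map (H \<restriction>\<^sub>h M) (K \<restriction>\<^sub>h N) T"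
  unfolding bounded_module_map_def by (simp add: subset_iff) blast

lemma bounded_module_map_comp:
  assumes P: "bounded_module_map H K P" and T: "bounded_module_map K L T"
  shows "bounded_module_map H L (T \<circ> P)"
proof -
  obtain B where B: "0 < B" "\<And>x. x \<in> hset H \<Longrightarrow> hnorm K (P x) \<le> B * hnorm H x"
    using bounded_module_map_bound[OF P] by blast
  obtain C where C: "0 < C" "\<And>x. x \<in> hset K \<Longrightarrow> hnorm L (T x) \<le> C * hnorm K x"
    using bounded_module_map_bound[OF T] by blast
  have "hnorm L (T (P x)) \<le> (C * B) * hnorm H x" if "x \<in> hset H" for x
  proof -
    have "hnorm L (T (P x)) \<le> C * hnorm K (P x)"
      using P that by (intro C) (auto simp: bounded_module_map_def)
    also have "\<dots> \<le> C * (B * hnorm H x)" using B C that by (intro mult_left_mono) auto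
    finally show ?thesis by (simp add: mult.assoc)
  qed
  then show ?thesis using P T unfolding bounded_module_map_def by (auto simp: image_subset_iff)
qed

lemma closed_submoduleD: "closed_submodule H M \<Longrightarrow> submodule H M" "closed_submodule H M \<Longrightarrow> M \<subseteq> hset H"
  by (auto simp: closed_submodule_def submodule_def)

context semi_inner_module
begin

lemma act_sum_right:
  assumes "finite I" "x \<in> hset H"
  shows "hact H x (sum f I) = (\<Sum>i\<in>I. hact H x (f i))"
  using assms
proof (induction I rule: finite_induct)
  case empty
  then show ?case using act_add_right[of x 0 0] by simp
qed (simp add: act_add_right)

lemma bmm_0: "bounded_module_map H K T \<Longrightarrow> T 0 = 0"
proof -
  assume "bounded_module_map H K T"
  then have "T (0 + 0) = T 0 + T 0" unfolding bounded_module_map_def by blast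
  then show ?thesis by simp
qed

lemma bmm_diff: "bounded_module_map H K T \<Longrightarrow> x \<in> hset H \<Longrightarrow> y \<in> hset H \<Longrightarrow> T (x - y) = T x - T y"
proof -
  assume "bounded_module_map H K T" "x \<in> hset H" "y \<in> hset H"
  then have "T ((x - y) + y) = T (x - y) + T y"
    unfolding bounded_module_map_def by blast
  then show ?thesis by simp
qed

lemma bmm_sum:
  assumes T: "bounded_module_map H K T" and f: "\<And>i. i \<in> I \<Longrightarrow> f i \<in> hset H"
  shows "T (sum f I) = (\<Sum>i\<in>I. T (f i))"
  using f
proof (induction I rule: infinite_finite_induct)
  case (insert i I)
  then have "T (f i + sum f I) = T (f i) + T (sum f I)"
    using T unfolding bounded_module_map_def by auto
  then show ?case using insert by simp
qed (simp_all add: bmm_0[OF T])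

lemma bmm_lim:
  assumes T: "bounded_module_map H K T"
    and s: "\<And>n. s n \<in> hset H" "x \<in> hset H" "(\<lambda>n. hnorm H (s n - x)) \<longlonglongrightarrow> 0"
  shows "(\<lambda>n. hnorm K (T (s n) - T x)) \<longlonglongrightarrow> 0"
proof -
  obtain B where B: "0 < B" "\<And>x. x \<in> hset H \<Longrightarrow> hnorm K (T x) \<le> B * hnorm H x"
    using bounded_module_map_bound[OF T] by blast
  show ?thesis
  proof (rule Lim_null_comparison[OF always_eventually])
    show "(\<lambda>n. B * hnorm H (s n - x)) \<longlonglongrightarrow> 0" by (rule tendsto_mult_right_zero) fact
    show "\<forall>n. norm (hnorm K (T (s n) - T x)) \<le> B * hnorm H (s n - x)"
      using B(2)[of "s _ - x"] s by (simp add: bmm_diff[OF T])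
  qed
qed

lemma submodule_vimage:
  assumes T: "bounded_module_map H K T" and N: "submodule K N"
  shows "submodule H {x \<in> hset H. T x \<in> N}"
  using T N bmm_0[OF T] unfolding submodule_def bounded_module_map_def by auto

lemma closed_submodule_vimage:
  assumes T: "bounded_module_map H K T" and N: "closed_submodule K N"
  shows "closed_submodule H {x \<in> hset H. T x \<in> N}"
  unfolding closed_submodule_def
proof (intro conjI allI impI submodule_vimage[OF T] closed_submoduleD(1)[OF N])
  fix s x
  assume s: "\<forall>n. s n \<in> {x \<in> hset H. T x \<in> N}" and x: "x \<in> hset H" "(\<lambda>n. hnorm H (s n - x)) \<longlonglongrightarrow> 0"
  have "T x \<in> N"
    by (rule closed_submodule_limit[OF N _ _ bmm_lim[OF T _ x]])
       (use s x T in \<open>auto simp: bounded_module_map_def\<close>)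
  then show "x \<in> {x \<in> hset H. T x \<in> N}" using x by simp
qed

lemma submodule_image:
  assumes T: "bounded_module_map H K T" and M: "submodule H M"
  shows "submodule K (T ` M)"
  unfolding submodule_def
proof (intro conjI ballI allI)
  show "T ` M \<subseteq> hset K" using bmm_closed[OF T] M unfolding submodule_def by auto
  show "0 \<in> T ` M" using bmm_0[OF T] M unfolding submodule_def by force
next
  fix x y assume "x \<in> T ` M" "y \<in> T ` M"
  then obtain u v where "u \<in> M" "v \<in> M" "x = T u" "y = T v" by blast
  then show "x + y \<in> T ` M"
    using M unfolding submodule_def
    by (intro image_eqI[of _ _ "u + v"]) (auto simp: bmm_add[OF T] subset_iff)
next
  fix x c assume "x \<in> T ` M"
  then obtain u where "u \<in> M" "x = T u" by blast
  then show "c *\<^sub>C x \<in> T ` M"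
    using M unfolding submodule_def
    by (intro image_eqI[of _ _ "c *\<^sub>C u"]) (auto simp: bmm_scaleC[OF T] subset_iff)
next
  fix x a assume "x \<in> T ` M"
  then obtain u where "u \<in> M" "x = T u" by blast
  then show "hact K x a \<in> T ` M"
    using M unfolding submodule_def
    by (intro image_eqI[of _ _ "hact H u a"]) (auto simp: bmm_act[OF T] subset_iff)
qed

section \<open>Finite generation\<close>

text \<open>Generators come as an indexed family here and as a set in the definition; indices with
  equal vectors are merged by adding their coefficients.\<close>

lemma finitely_generated_if_family:
  assumes I: "finite I" and v: "\<And>i. i \<in> I \<Longrightarrow> v i \<in> hset H"
    and gen: "\<And>x. x \<in> hset H \<Longrightarrow> \<exists>a. x = (\<Sum>i\<in>I. hact H (v i) (a i))"
  shows "finitely_generated H"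
  unfolding finitely_generated_def
proof (intro exI[of _ "v ` I"] conjI equalityI subsetI)
  fix x assume "x \<in> hset H"
  then obtain a where a: "x = (\<Sum>i\<in>I. hact H (v i) (a i))" using gen by blast
  have "x = (\<Sum>y\<in>v ` I. \<Sum>i\<in>{i \<in> I. v i = y}. hact H (v i) (a i))"
    unfolding a by (rule sum.image_gen[OF I])
  also have "\<dots> = (\<Sum>y\<in>v ` I. 0 *\<^sub>C y + hact H y (\<Sum>i\<in>{i \<in> I. v i = y}. a i))"
    using I v by (intro sum.cong) (auto simp: act_sum_right)
  finally show "x \<in> {\<Sum>x\<in>v ` I. c x *\<^sub>C x + hact H x (a x) | c a. True}"
    by (intro CollectI exI[of _ "\<lambda>_. 0"] exI[of _ "\<lambda>y. \<Sum>i\<in>{i \<in> I. v i = y}. a i"]) simp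
next
  fix x assume "x \<in> {\<Sum>x\<in>v ` I. c x *\<^sub>C x + hact H x (a x) | c a. True}"
  then obtain c a where "x = (\<Sum>x\<in>v ` I. c x *\<^sub>C x + hact H x (a x))" by blast
  then show "x \<in> hset H" using v by auto
qed (use I v in auto)

lemma finitely_generatedE:
  assumes "finitely_generated H"
  obtains S where "finite S" "S \<subseteq> hset H" "\<And>x. x \<in> hset H \<Longrightarrow> \<exists>a. x = (\<Sum>s\<in>S. hact H s (a s))"
proof -
  obtain S where S: "finite S" "S \<subseteq> hset H" "hset H = {\<Sum>x\<in>S. c x *\<^sub>C x + hact H x (a x) | c a. True}"
    using assms unfolding finitely_generated_def by auto
  show thesis
  proof (rule that[OF S(1,2)])
    fix x assume "x \<in> hset H"
    then obtain c a where "x = (\<Sum>x\<in>S. c x *\<^sub>C x + hact H x (a x))" using S(3) by blast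
    \<comment> \<open>The complex coefficient is absorbed into the algebra coefficient as a multiple
      of the unit.\<close>
    also have "\<dots> = (\<Sum>s\<in>S. hact H s (c s *\<^sub>C 1 + a s))"
      using S(2) by (intro sum.cong) (auto simp: act_add_right scaleC_eq_act)
    finally show "\<exists>a. x = (\<Sum>s\<in>S. hact H s (a s))"
      by (intro exI[of _ "\<lambda>s. c s *\<^sub>C 1 + a s"])
  qed
qed

lemma finitely_generated_iso:
  assumes U: "module_iso H K U" and K: "semi_inner_module K" and fg: "finitely_generated H"
  shows "finitely_generated K"
proof -
  have bmm: "bounded_module_map H K U" and img: "U ` hset H = hset K"
    using U by (auto simp: module_iso_def bij_betw_def)
  obtain S where S: "finite S" "S \<subseteq> hset H" "\<And>x. x \<in> hset H \<Longrightarrow> \<exists>a. x = (\<Sum>s\<in>S. hact H s (a s))"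
    using finitely_generatedE[OF fg] by blast
  show ?thesis
  proof (rule semi_inner_module.finitely_generated_if_family[OF K S(1), of U])
    fix y assume "y \<in> hset K"
    then obtain x where x: "x \<in> hset H" "y = U x" using img by blast
    then obtain a where "x = (\<Sum>s\<in>S. hact H s (a s))" using S by blast
    then have "y = (\<Sum>s\<in>S. U (hact H s (a s)))"
      using S(2) x(2) by (auto simp: bmm_sum[OF bmm] subset_iff)
    also have "\<dots> = (\<Sum>s\<in>S. hact K (U s) (a s))"
      using bmm S(2) by (intro sum.cong) (auto simp: bounded_module_map_def)
    finally show "\<exists>a. y = (\<Sum>s\<in>S. hact K (U s) (a s))" by blast
  qed (use S(2) img in auto)
qed

end

section \<open>Lower bounds, closed images and diagonal decompositions\<close>

lemma module_isoE:
  assumes "module_iso H K T"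
  obtains B where "0 < B" "\<And>x. x \<in> hset H \<Longrightarrow> hnorm H x \<le> B * hnorm K (T x)"
proof -
  have bij: "bij_betw T (hset H) (hset K)" and inv: "bounded_module_map K H (inv_into (hset H) T)"
    using assms by (auto simp: module_iso_def)
  obtain B where B: "0 < B" "\<And>y. y \<in> hset K \<Longrightarrow> hnorm H (inv_into (hset H) T y) \<le> B * hnorm K y"
    using bounded_module_map_bound[OF inv] by blast
  show thesis
  proof (rule that[OF B(1)])
    fix x assume "x \<in> hset H"
    then show "hnorm H x \<le> B * hnorm K (T x)"
      using B(2)[of "T x"] bij bij_betwE[OF bij] by (simp add: bij_betw_inv_into_left)
  qed
qed

context hilbert_module
begin

lemma module_iso_if_bounded_below:
  assumes T: "bounded_module_map H K T" and img: "T ` hset H = hset K"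
    and K: "semi_inner_module K"
    and below: "\<And>x. x \<in> hset H \<Longrightarrow> hnorm H x \<le> B * hnorm K (T x)"
  shows "module_iso H K T"
proof -
  interpret K: semi_inner_module K by fact
  have inj: "inj_on T (hset H)"
  proof (rule inj_onI)
    fix x y assume xy: "x \<in> hset H" "y \<in> hset H" "T x = T y"
    then have "hnorm H (x - y) \<le> 0" using below[of "x - y"] by (simp add: bmm_diff[OF T])
    then show "x = y" using xy hnorm_eq_0[of "x - y"] hnorm_nonneg[of H "x - y"] by auto
  qed
  define V where "V = inv_into (hset H) T"
  have TV: "T (V y) = y" "V y \<in> hset H" if "y \<in> hset K" for y
    using that img by (auto simp: V_def f_inv_into_f inv_into_into)
  have VT: "V y = x" if "x \<in> hset H" "T x = y" for x y
    using that inj by (auto simp: V_def)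
  have "bounded_module_map K H V"
    unfolding bounded_module_map_def
  proof (intro conjI ballI allI exI)
    fix x y assume "x \<in> hset K" "y \<in> hset K"
    then show "V (x + y) = V x + V y"
      using T TV by (intro VT) (auto simp: bounded_module_map_def)
  next
    fix x c assume "x \<in> hset K"
    then show "V (c *\<^sub>C x) = c *\<^sub>C V x"
      using T TV by (intro VT) (auto simp: bounded_module_map_def)
  next
    fix x a assume "x \<in> hset K"
    then show "V (hact K x a) = hact H (V x) a"
      using T TV by (intro VT) (auto simp: bounded_module_map_def)
  next
    fix x assume "x \<in> hset K"
    then show "hnorm H (V x) \<le> B * hnorm K x" using below[of "V x"] TV by simp
  qed (use TV in auto)
  then show ?thesis using T inj img by (auto simp: module_iso_def bij_betw_def V_def)
qed

text \<open>The lower bound makes a sequence in \<open>M\<close> Cauchy whenever its image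
  converges, and \<open>M\<close> is complete.\<close>

lemma closed_submodule_image:
  assumes T: "bounded_module_map H K T" and M: "closed_submodule H M"
    and K: "hilbert_module K"
    and below: "\<And>x. x \<in> M \<Longrightarrow> hnorm H x \<le> B * hnorm K (T x)"
  shows "closed_submodule K (T ` M)"
  unfolding closed_submodule_def
proof (intro conjI allI impI submodule_image[OF T closed_submoduleD(1)[OF M]])
  interpret K: hilbert_module K by fact
  interpret M: hilbert_module "H \<restriction>\<^sub>h M" by (rule hilbert_module_restrict) fact
  have Min: "x \<in> hset H" "T x \<in> hset K" if "x \<in> M" for x
    using closed_submoduleD(2)[OF M] T that by (auto simp: bounded_module_map_def)
  fix s y
  assume "\<forall>n. s n \<in> T ` M" and y: "y \<in> hset K" and lim: "(\<lambda>n. hnorm K (s n - y)) \<longlonglongrightarrow> 0"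
  then obtain t where t: "\<And>n. t n \<in> M" "\<And>n. s n = T (t n)" by (metis image_iff)
  have le: "hnorm H (t m - t n) \<le> \<bar>B\<bar> * (hnorm K (s m - y) + hnorm K (s n - y))" for m n
  proof -
    have "hnorm H (t m - t n) \<le> B * hnorm K (T (t m - t n))"
      using M.diff_closed[of "t m" "t n"] t by (intro below) simp
    also have "\<dots> = B * hnorm K (s m - s n)" by (simp add: t Min bmm_diff[OF T])
    also have "\<dots> \<le> \<bar>B\<bar> * hnorm K (s m - s n)" by (intro mult_right_mono) auto
    also have "\<dots> \<le> \<bar>B\<bar> * (hnorm K (s m - y) + hnorm K (s n - y))"
      using K.hnorm_triangle_diff[of "s m" y "s n"] K.hnorm_minus_commute[of y "s n"] y
      by (intro mult_left_mono) (auto simp: t Min)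
    finally show ?thesis .
  qed
  have "\<exists>x\<in>hset (H \<restriction>\<^sub>h M). (\<lambda>n. hnorm (H \<restriction>\<^sub>h M) (t n - x)) \<longlonglongrightarrow> 0"
  proof (rule M.complete)
    fix e :: real assume e: "e > 0"
    \<comment> \<open>\<open>B\<close> may be 0 or negative; \<open>\<bar>B\<bar> + 1\<close> is a
      positive substitute that can be divided by.\<close>
    define c where "c = \<bar>B\<bar> + 1"
    have c: "c > 0" by (simp add: c_def add_nonneg_pos)
    define d where "d = e / (2 * c)"
    have d: "d > 0" using e c by (simp add: d_def)
    obtain N where N: "\<And>n. n \<ge> N \<Longrightarrow> hnorm K (s n - y) < d"
      using LIMSEQ_D[OF lim d] by auto
    have "hnorm H (t m - t n) < e" if "m \<ge> N" "n \<ge> N" for m n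
    proof -
      have "hnorm H (t m - t n) \<le> \<bar>B\<bar> * (d + d)"
        using N[OF that(1)] N[OF that(2)] by (intro order_trans[OF le] mult_left_mono) auto
      also have "\<dots> < c * (d + d)" using d by (simp add: c_def)
      also have "\<dots> = e" using c by (simp add: d_def)
      finally show ?thesis .
    qed
    then show "\<exists>N. \<forall>m\<ge>N. \<forall>n\<ge>N. hnorm (H \<restriction>\<^sub>h M) (t m - t n) < e" by auto
  qed (use t in auto)
  then obtain x where x: "x \<in> M" "(\<lambda>n. hnorm H (t n - x)) \<longlonglongrightarrow> 0" by auto
  have "(\<lambda>n. hnorm K (s n - T x)) \<longlonglongrightarrow> 0"
    unfolding t using x t Min by (intro bmm_lim[OF T]) auto
  then have "T x = y"
    using K.lim_unique[of s "T x" y] x y lim by (simp add: t Min)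
  then show "y \<in> T ` M" using x by blast
qed

lemma direct_decompD:
  assumes "direct_decomp H M N"
  shows "closed_submodule H M" "closed_submodule H N" "M \<inter> N = {0}"
    "\<And>x. x \<in> hset H \<Longrightarrow> \<exists>m\<in>M. \<exists>n\<in>N. x = m + n" "M \<subseteq> hset H" "N \<subseteq> hset H"
  using assms closed_submoduleD(2)[of H M] closed_submoduleD(2)[of H N]
  unfolding direct_decomp_def by blast+

lemma diag_iso_decompI:
  assumes T: "bounded_module_map H H T"
    and d: "direct_decomp H M1 N1" "direct_decomp H M2 N2" "T ` M1 = M2" "T ` N1 \<subseteq> N2"
    and below: "\<And>x. x \<in> M1 \<Longrightarrow> hnorm H x \<le> B * hnorm H (T x)"
  shows "diag_iso_decomp H T M1 N1 M2 N2"
proof -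
  interpret M1: hilbert_module "H \<restriction>\<^sub>h M1" by (rule hilbert_module_restrict direct_decompD d)+
  have "module_iso (H \<restriction>\<^sub>h M1) (H \<restriction>\<^sub>h M2) T"
    using d T below direct_decompD[OF d(1)] direct_decompD[OF d(2)] closed_submoduleD
    by (intro M1.module_iso_if_bounded_below[where B = B] bounded_module_map_restrict
        semi_inner_module_restrict) auto
  then show ?thesis using d by (auto simp: diag_iso_decomp_def)
qed

lemma diag_iso_decompE:
  assumes "diag_iso_decomp H T M1 N1 M2 N2"
  obtains B where "direct_decomp H M1 N1" "direct_decomp H M2 N2" "T ` M1 = M2" "T ` N1 \<subseteq> N2"
    "0 < B" "\<And>x. x \<in> M1 \<Longrightarrow> hnorm H x \<le> B * hnorm H (T x)"
proof -
  have iso: "module_iso (H \<restriction>\<^sub>h M1) (H \<restriction>\<^sub>h M2) T" using assms by (simp add: diag_iso_decomp_def)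
  obtain B where "0 < B" "\<And>x. x \<in> hset (H \<restriction>\<^sub>h M1) \<Longrightarrow> hnorm (H \<restriction>\<^sub>h M1) x \<le> B * hnorm (H \<restriction>\<^sub>h M2) (T x)"
    using module_isoE[OF iso] by blast
  then show thesis
    using assms iso that[of B] by (auto simp: diag_iso_decomp_def module_iso_def bij_betw_def)
qed

text \<open>Every \<open>y\<close> splits because \<open>T y = T (P x) + n\<close> with
  \<open>x\<close> in \<open>M1\<close> and \<open>n\<close> in \<open>N2\<close>, so that
  \<open>y - P x\<close> lies in \<open>N\<close>. The lower bounds come from squeezing: boundedness
  of \<open>T\<close> makes \<open>P\<close> bounded below on \<open>M1\<close>, and boundedness of
  \<open>P\<close> makes \<open>T\<close> bounded below on the image of \<open>M1\<close>.\<close>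

lemma diag_iso_decomp_factor:
  assumes P: "bounded_module_map H H P" and T: "bounded_module_map H H T"
    and TP: "diag_iso_decomp H (T \<circ> P) M1 N1 M2 N2"
  defines "N \<equiv> {x \<in> hset H. T x \<in> N2}"
  shows "diag_iso_decomp H P M1 N1 (P ` M1) N" "diag_iso_decomp H T (P ` M1) N M2 N2"
proof -
  obtain B where d1: "direct_decomp H M1 N1" and d2: "direct_decomp H M2 N2"
    and img: "(T \<circ> P) ` M1 = M2" "(T \<circ> P) ` N1 \<subseteq> N2" and B: "0 < B"
    and below: "\<And>x. x \<in> M1 \<Longrightarrow> hnorm H x \<le> B * hnorm H (T (P x))"
    using diag_iso_decompE[OF TP] unfolding o_def by blast
  note d1 = d1 direct_decompD[OF d1] and d2 = d2 direct_decompD[OF d2]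
  obtain C where C: "0 < C" "\<And>x. x \<in> hset H \<Longrightarrow> hnorm H (T x) \<le> C * hnorm H x"
    using bounded_module_map_bound[OF T] by blast
  obtain E where E: "0 < E" "\<And>x. x \<in> hset H \<Longrightarrow> hnorm H (P x) \<le> E * hnorm H x"
    using bounded_module_map_bound[OF P] by blast
  have PH: "P x \<in> hset H" "T x \<in> hset H" if "x \<in> hset H" for x
    using P T that by (auto simp: bounded_module_map_def)
  have belowP: "hnorm H x \<le> (B * C) * hnorm H (P x)" if "x \<in> M1" for x
  proof -
    have "B * hnorm H (T (P x)) \<le> B * (C * hnorm H (P x))"
      using B that d1 PH by (intro mult_left_mono C) auto
    then show ?thesis using below[OF that] by simp
  qed
  have belowT: "hnorm H y \<le> (E * B) * hnorm H (T y)" if y: "y \<in> P ` M1" for y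
  proof -
    obtain x where x: "x \<in> M1" "y = P x" using y by blast
    have "hnorm H (P x) \<le> E * hnorm H x" using x d1 by (intro E) auto
    also have "\<dots> \<le> E * (B * hnorm H (T (P x)))" using below x E by (intro mult_left_mono) auto
    finally show ?thesis using x by simp
  qed
  have dN: "direct_decomp H (P ` M1) N"
    unfolding direct_decomp_def
  proof (intro conjI equalityI subsetI)
    show "closed_submodule H (P ` M1)"
      by (rule closed_submodule_image[OF P d1(2) hilbert_module_axioms belowP])
    show "closed_submodule H N"
      unfolding N_def by (rule closed_submodule_vimage[OF T d2(3)])
  next
    fix y assume "y \<in> P ` M1 \<inter> N"
    then obtain x where x: "x \<in> M1" "y = P x" "T (P x) \<in> N2" by (auto simp: N_def)
    then have "T (P x) = 0" using img(1) d2(4) by fastforce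
    then have "hnorm H x \<le> 0" using below[OF x(1)] by simp
    then have "x = 0" using hnorm_eq_0[of x] hnorm_nonneg[of H x] x(1) d1(6) by auto
    then show "y \<in> {0}" using x bmm_0[OF P] by simp
  next
    fix y :: 'b assume "y \<in> {0}"
    then show "y \<in> P ` M1 \<inter> N"
      using closed_submoduleD(1)[OF d1(2)] closed_submoduleD(1)[OF d2(3)] bmm_0[OF P] bmm_0[OF T]
      by (force simp: N_def submodule_def)
  next
    fix y assume y: "y \<in> hset H"
    obtain m n where mn: "m \<in> M2" "n \<in> N2" "T y = m + n" using d2(5)[OF PH(2)[OF y]] by blast
    then obtain x where x: "x \<in> M1" "m = T (P x)" using img(1) by auto
    have "P x \<in> hset H" using x d1 PH by blast
    then have "y - P x \<in> N" using y mn x by (simp add: N_def bmm_diff[OF T])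
    then show "y \<in> {m + n | m n. m \<in> P ` M1 \<and> n \<in> N}" using x by force
  next
    fix y assume "y \<in> {m + n | m n. m \<in> P ` M1 \<and> n \<in> N}"
    then show "y \<in> hset H" using PH d1 by (auto simp: N_def)
  qed
  show "diag_iso_decomp H P M1 N1 (P ` M1) N"
    using img d1 PH by (intro diag_iso_decompI[OF P d1(1) dN _ _ belowP]) (auto simp: N_def)
  show "diag_iso_decomp H T (P ` M1) N M2 N2"
    using img by (intro diag_iso_decompI[OF T dN d2(1) _ _ belowT]) (auto simp: N_def)
qed

end

context hilbert_module
begin

lemma direct_decompI:
  assumes M: "closed_submodule H M" and N: "closed_submodule H N"
    and zero: "\<And>x. x \<in> M \<Longrightarrow> x \<in> N \<Longrightarrow> x = 0"
    and split: "\<And>x. x \<in> hset H \<Longrightarrow> \<exists>m\<in>M. x - m \<in> N"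
  shows "direct_decomp H M N"
  unfolding direct_decomp_def
proof (intro conjI M N equalityI subsetI)
  fix x assume "x \<in> hset H"
  then obtain m where "m \<in> M" "x - m \<in> N" using split by blast
  then show "x \<in> {m + n | m n. m \<in> M \<and> n \<in> N}"
    by (intro CollectI exI[of _ m] exI[of _ "x - m"]) simp
next
  fix x assume "x \<in> {m + n | m n. m \<in> M \<and> n \<in> N}"
  then show "x \<in> hset H" using closed_submoduleD(2)[OF M] closed_submoduleD(2)[OF N] by auto
qed (use zero closed_submoduleD(1)[OF M] closed_submoduleD(1)[OF N] in \<open>auto simp: submodule_def\<close>)

section \<open>Bounded oblique projections and bounded coefficients\<close>

text \<open>This is boundedness of the oblique projection onto \<open>M\<close> along
  \<open>N\<close>. The gauge \<open>A r\<close> collects the sums whose \<open>M\<close>-part has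
  norm at most \<open>r\<close>; the \<open>N\<close>-part is left unrestricted.\<close>

lemma direct_decomp_bound:
  assumes "direct_decomp H M N"
  obtains B where "0 < B" "\<And>m n. m \<in> M \<Longrightarrow> n \<in> N \<Longrightarrow> hnorm H m \<le> B * hnorm H (m + n)"
proof -
  note d = direct_decompD[OF assms]
  interpret M: hilbert_module "H \<restriction>\<^sub>h M" by (rule hilbert_module_restrict d)+
  interpret N: hilbert_module "H \<restriction>\<^sub>h N" by (rule hilbert_module_restrict d)+
  have MH: "m \<in> hset H" if "m \<in> M" for m using d(5) that by blast
  have NH: "n \<in> hset H" if "n \<in> N" for n using d(6) that by blast
  define A where "A r = {m + n | m n. m \<in> M \<and> n \<in> N \<and> hnorm H m \<le> r}" for r
  have AI: "m + n \<in> A r" if "m \<in> M" "n \<in> N" "hnorm H m \<le> r" for m n r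
    using that by (auto simp: A_def)
  obtain C where C: "0 < C" "\<And>x. x \<in> hset H \<Longrightarrow> x \<in> A (C * hnorm H x)"
  proof (rule bounded_gauge[of A])
    show "\<exists>r. x \<in> A r" if "x \<in> hset H" for x
      using d(4)[OF that] AI by blast
    show "A r \<subseteq> hset H" for r using MH NH by (auto simp: A_def)
    show "A r \<subseteq> A s" if "r \<le> s" for r s using that by (force simp: A_def)
    show "x - y \<in> A (r + s)" if xy: "x \<in> A r" "y \<in> A s" for x y r s
    proof -
      obtain m n m' n' where *: "m \<in> M" "n \<in> N" "hnorm H m \<le> r" "x = m + n"
          "m' \<in> M" "n' \<in> N" "hnorm H m' \<le> s" "y = m' + n'"
        using xy by (auto simp: A_def)
      have "(m - m') + (n - n') \<in> A (r + s)"
        using * M.diff_closed[of m m'] N.diff_closed[of n n'] MH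
        by (intro AI order_trans[OF hnorm_diff_le]) auto
      then show ?thesis using * by (simp add: algebra_simps)
    qed
    show "complex_of_real c *\<^sub>C x \<in> A (c * r)" if x: "x \<in> A r" "0 \<le> c" for x r c
    proof -
      obtain m n where *: "m \<in> M" "n \<in> N" "hnorm H m \<le> r" "x = m + n"
        using x(1) by (auto simp: A_def)
      have "complex_of_real c *\<^sub>C m + complex_of_real c *\<^sub>C n \<in> A (c * r)"
        using * M.scaleC_closed[of m] N.scaleC_closed[of n] MH x(2)
        by (intro AI) (auto simp: hnorm_scaleC mult_left_mono)
      then show ?thesis using * by (simp add: scaleC_add_right)
    qed
    show "x \<in> A R" if f: "\<And>k. f k \<in> A (r k)" and r: "r sums R" and x: "x \<in> hset H"
        and lim: "(\<lambda>n. hnorm H ((\<Sum>k<n. f k) - x)) \<longlonglongrightarrow> 0" for f r R x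
    proof -
      have "\<exists>m n. m \<in> M \<and> n \<in> N \<and> hnorm H m \<le> r k \<and> f k = m + n" for k
        using f[of k] by (auto simp: A_def)
      then obtain m n where mn: "\<And>k. m k \<in> M" "\<And>k. n k \<in> N" "\<And>k. hnorm H (m k) \<le> r k"
          "\<And>k. f k = m k + n k" by metis
      \<comment> \<open>The \<open>M\<close>-parts converge absolutely to \<open>y\<close>; the
        partial sums of the \<open>N\<close>-parts then tend to \<open>x - y\<close>, and closedness
        of \<open>N\<close> keeps this limit in \<open>N\<close>.\<close>
      obtain y where y: "y \<in> M" "(\<lambda>n. hnorm H ((\<Sum>k<n. m k) - y)) \<longlonglongrightarrow> 0" "hnorm H y \<le> R"
        using M.absolutely_convergent[OF _ _ r, of m] mn by auto
      have sumM: "(\<Sum>k<j. m k) \<in> M" for j using M.sum_closed[of "{..<j}" m] mn by simp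
      have sumN: "(\<Sum>k<j. n k) \<in> N" for j using N.sum_closed[of "{..<j}" n] mn by simp
      have eq: "(\<Sum>k<j. f k) - (\<Sum>k<j. m k) = (\<Sum>k<j. n k)" for j
        by (simp add: mn sum.distrib)
      have "(\<lambda>j. hnorm H (((\<Sum>k<j. f k) - (\<Sum>k<j. m k)) - (x - y))) \<longlonglongrightarrow> 0"
        using mn MH NH sumM y x by (intro lim_diff[OF _ _ x _ lim y(2)]) auto
      then have "(\<lambda>j. hnorm H ((\<Sum>k<j. n k) - (x - y))) \<longlonglongrightarrow> 0" by (simp only: eq)
      then have "x - y \<in> N" by (rule closed_submodule_limit[OF d(2) sumN diff_closed[OF x MH[OF y(1)]]])
      then have "y + (x - y) \<in> A R" using y by (intro AI) auto
      then show ?thesis by simp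
    qed
  qed (rule that)
  have "hnorm H m \<le> C * hnorm H (m + n)" if mn: "m \<in> M" "n \<in> N" for m n
  proof -
    have "m + n \<in> A (C * hnorm H (m + n))" using mn MH NH by (intro C) auto
    then obtain m' n' where *: "m' \<in> M" "n' \<in> N" "hnorm H m' \<le> C * hnorm H (m + n)" "m + n = m' + n'"
      by (auto simp: A_def)
    have "m - m' = n' - n" using *(4) by (simp add: algebra_simps)
    then have "m - m' \<in> M \<inter> N"
      using M.diff_closed[of m m'] N.diff_closed[of n' n] * mn by auto
    then show ?thesis using d(3) * by auto
  qed
  then show thesis using C(1) that by blast
qed

text \<open>The locale ties scalars to the action but does not state associativity of the action.
  The difference \<open>w\<close> of the two sides is orthogonal to itself, and definiteness makes
  it 0.\<close>

lemma act_scaleC: "x \<in> hset H \<Longrightarrow> hact H x (c *\<^sub>C a) = c *\<^sub>C hact H x a"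
proof -
  assume x: "x \<in> hset H"
  define w where "w = hact H x (c *\<^sub>C a) + - (c *\<^sub>C hact H x a)"
  have w: "w \<in> hset H" using x by (simp add: w_def)
  have "hinner H w w = hinner H w x * (c *\<^sub>C a) - c *\<^sub>C (hinner H w x * a)"
    using x w unfolding w_def[THEN arg_cong, of "hinner H w"]
    by (simp del: add_uminus_conv_diff add: inner_add inner_minus inner_act inner_scaleC)
  then have "w = 0" using w by (intro inner_definite) (auto simp: mult_scaleC_right)
  then show ?thesis by (simp add: w_def)
qed

text \<open>The open mapping theorem for the map from coefficient families to \<open>H\<close>:
  representations need not be unique, but one can be chosen with coefficients controlled by the norm
  of \<open>x\<close>. Uniform smallness of tails on the unit ball follows from this.\<close>

lemma finitely_generated_bound:
  assumes "finitely_generated H"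
  obtains S C where "finite S" "S \<subseteq> hset H" "0 < C"
    "\<And>x. x \<in> hset H \<Longrightarrow> \<exists>a. x = (\<Sum>s\<in>S. hact H s (a s)) \<and> (\<forall>s\<in>S. norm (a s) \<le> C * hnorm H x)"
proof -
  obtain S where S: "finite S" "S \<subseteq> hset H" "\<And>x. x \<in> hset H \<Longrightarrow> \<exists>a. x = (\<Sum>s\<in>S. hact H s (a s))"
    using finitely_generatedE[OF assms] by blast
  have SH: "s \<in> hset H" if "s \<in> S" for s using S(2) that by blast
  define A where "A r = {\<Sum>s\<in>S. hact H s (a s) | a. \<forall>s\<in>S. norm (a s) \<le> r}" for r
  have AI: "(\<Sum>s\<in>S. hact H s (a s)) \<in> A r" if "\<And>s. s \<in> S \<Longrightarrow> norm (a s) \<le> r" for a r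
    using that by (auto simp: A_def)
  have act_diff: "hact H s (a - b) = hact H s a - hact H s b" if "s \<in> S" for s a b
    using act_add_right[OF SH[OF that], of "a - b" b] by (simp add: algebra_simps)
  obtain C where C: "0 < C" "\<And>x. x \<in> hset H \<Longrightarrow> x \<in> A (C * hnorm H x)"
  proof (rule bounded_gauge[of A])
    show "\<exists>r. x \<in> A r" if x: "x \<in> hset H" for x
    proof -
      obtain a where "x = (\<Sum>s\<in>S. hact H s (a s))" using S(3)[OF x] by blast
      then have "x \<in> A (\<Sum>s\<in>S. norm (a s))"
        using AI[of a "\<Sum>s\<in>S. norm (a s)"] S(1) member_le_sum[of _ S "\<lambda>s. norm (a s)"] by simp
      then show ?thesis by blast
    qed
    show "A r \<subseteq> hset H" for r using SH by (auto simp: A_def)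
    show "A r \<subseteq> A s" if "r \<le> s" for r s using that by (force simp: A_def)
    show "x - y \<in> A (r + s)" if xy: "x \<in> A r" "y \<in> A s" for x y r s
    proof -
      obtain a b where *: "x = (\<Sum>s\<in>S. hact H s (a s))" "y = (\<Sum>s\<in>S. hact H s (b s))"
          "\<forall>s\<in>S. norm (a s) \<le> r" "\<forall>t\<in>S. norm (b t) \<le> s"
        using xy by (auto simp: A_def)
      have "(\<Sum>s\<in>S. hact H s (a s - b s)) \<in> A (r + s)"
        using * by (intro AI order_trans[OF norm_triangle_ineq4] add_mono) auto
      then show ?thesis using * by (simp add: act_diff sum_subtractf)
    qed
    show "complex_of_real c *\<^sub>C x \<in> A (c * r)" if x: "x \<in> A r" "0 \<le> c" for x r c
    proof -
      obtain a where *: "x = (\<Sum>s\<in>S. hact H s (a s))" "\<forall>s\<in>S. norm (a s) \<le> r"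
        using x(1) by (auto simp: A_def)
      have "complex_of_real c *\<^sub>C x = (\<Sum>s\<in>S. hact H s (complex_of_real c *\<^sub>C a s))"
        using SH by (simp add: *(1) scaleC_sum act_scaleC)
      also have "\<dots> \<in> A (c * r)"
        using * x(2) by (intro AI) (auto simp: norm_scaleC mult_left_mono)
      finally show ?thesis .
    qed
    show "x \<in> A R" if f: "\<And>k. f k \<in> A (r k)" and r: "r sums R" and x: "x \<in> hset H"
        and lim: "(\<lambda>n. hnorm H ((\<Sum>k<n. f k) - x)) \<longlonglongrightarrow> 0" for f r R x
    proof -
      have "\<exists>a. f k = (\<Sum>s\<in>S. hact H s (a s)) \<and> (\<forall>s\<in>S. norm (a s) \<le> r k)" for k
        using f[of k] by (auto simp: A_def)
      then obtain a where a: "\<And>k. f k = (\<Sum>s\<in>S. hact H s (a k s))" "\<And>k s. s \<in> S \<Longrightarrow> norm (a k s) \<le> r k"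
        by metis
      define b where "b s = (\<Sum>k. a k s)" for s
      have summable: "summable (\<lambda>k. norm (a k s))" if "s \<in> S" for s
        by (rule summable_comparison_test'[OF sums_summable[OF r], of 0]) (use a(2) that in auto)
      have b: "(\<lambda>n. \<Sum>k<n. a k s) \<longlonglongrightarrow> b s" "norm (b s) \<le> R" if "s \<in> S" for s
      proof -
        show "(\<lambda>n. \<Sum>k<n. a k s) \<longlonglongrightarrow> b s"
          unfolding b_def by (rule summable_LIMSEQ[OF summable_norm_cancel[OF summable[OF that]]])
        have "norm (b s) \<le> (\<Sum>k. norm (a k s))"
          unfolding b_def by (rule summable_norm[OF summable[OF that]])
        also have "\<dots> \<le> R"
          using suminf_le[OF a(2)[OF that] summable[OF that] sums_summable[OF r]] sums_unique[OF r] by simp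
        finally show "norm (b s) \<le> R" .
      qed
      have fsum: "(\<Sum>k<n. f k) = (\<Sum>s\<in>S. hact H s (\<Sum>k<n. a k s))" for n
        unfolding a(1) by (subst sum.swap) (simp add: act_sum_right SH)
      let ?y = "\<Sum>s\<in>S. hact H s (b s)"
      have "(\<lambda>n. hnorm H ((\<Sum>k<n. f k) - ?y)) \<longlonglongrightarrow> 0"
      proof (rule Lim_null_comparison[OF always_eventually])
        show "(\<lambda>n. \<Sum>s\<in>S. hnorm H s * norm ((\<Sum>k<n. a k s) - b s)) \<longlonglongrightarrow> 0"
          by (intro tendsto_null_sum tendsto_mult_right_zero tendsto_norm_zero LIM_zero b)
        have "(\<Sum>k<n. f k) - ?y = (\<Sum>s\<in>S. hact H s ((\<Sum>k<n. a k s) - b s))" for n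
          by (simp add: fsum act_diff sum_subtractf)
        then show "\<forall>n. norm (hnorm H ((\<Sum>k<n. f k) - ?y)) \<le> (\<Sum>s\<in>S. hnorm H s * norm ((\<Sum>k<n. a k s) - b s))"
          using SH by (auto intro!: order_trans[OF hnorm_sum sum_mono] hnorm_act)
      qed
      then have "?y = x"
        using SH by (intro lim_unique[OF _ _ x _ lim]) (auto simp: fsum)
      then show ?thesis using AI[of b R] b by blast
    qed
  qed (rule that)
  show thesis
    using C by (intro that[OF S(1,2) C(1)]) (force simp: A_def)
qed

section \<open>Decompositions from approximate left inverses, and conversely\<close>

text \<open>On \<open>L\<close> the map \<open>R \<circ> T\<close> is within 1/2 of the identity,
  hence bijective. So \<open>L\<close> complements the kernel \<open>N\<close> of
  \<open>R \<circ> T\<close> in the domain, and the image of \<open>L\<close> under \<open>T\<close>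
  complements the kernel \<open>N2\<close> of \<open>R\<close> in the codomain.\<close>

lemma diag_iso_decomp_of_left_inverse:
  assumes T: "bounded_module_map H H T" and R: "bounded_module_map H H R"
    and L: "closed_submodule H L" and RL: "\<And>x. x \<in> hset H \<Longrightarrow> R x \<in> L"
    and near: "\<And>x. x \<in> L \<Longrightarrow> hnorm H (x - R (T x)) \<le> hnorm H x / 2"
    and I: "finite I" "\<And>i. i \<in> I \<Longrightarrow> v i \<in> hset H"
    and gen: "\<And>x. x \<in> hset H \<Longrightarrow> \<exists>l\<in>L. \<exists>a. x = l + (\<Sum>i\<in>I. hact H (v i) (a i))"
  obtains N M2 N2 where "diag_iso_decomp H T L N M2 N2" "finitely_generated (H \<restriction>\<^sub>h N)"
proof -
  interpret L: hilbert_module "H \<restriction>\<^sub>h L" by (rule hilbert_module_restrict L)+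
  have LH: "l \<in> hset H" if "l \<in> L" for l using closed_submoduleD(2)[OF L] that by blast
  have TH: "T x \<in> hset H" if "x \<in> hset H" for x using bmm_closed[OF T that] .
  have RT: "bounded_module_map H H (R \<circ> T)" by (rule bounded_module_map_comp[OF T R])
  have below1: "hnorm H x \<le> 2 * hnorm H (R (T x))" if "x \<in> L" for x
    using hnorm_triangle[of "x - R (T x)" "R (T x)"] near[OF that] LH TH RL that by simp
  obtain B where B: "0 < B" "\<And>x. x \<in> hset H \<Longrightarrow> hnorm H (R x) \<le> B * hnorm H x"
    using bounded_module_map_bound[OF R] by blast
  have below: "hnorm H x \<le> (2 * B) * hnorm H (T x)" if "x \<in> L" for x
    using below1[OF that] B(2)[OF TH[OF LH[OF that]]] by simp
  have inj: "x = 0" if "x \<in> L" "R (T x) = 0" for x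
    using below1[OF that(1)] that hnorm_eq_0[OF LH[OF that(1)]] hnorm_nonneg[of H x] by auto
  have surj: "\<exists>x\<in>L. R (T x) = y" if y: "y \<in> L" for y
  proof -
    obtain x where "x \<in> hset (H \<restriction>\<^sub>h L)" "(R \<circ> T) x = y"
    proof (rule L.surj_if_near_id[of "R \<circ> T" y])
      show "(R \<circ> T) (x - y) = (R \<circ> T) x - (R \<circ> T) y" if "x \<in> hset (H \<restriction>\<^sub>h L)" "y \<in> hset (H \<restriction>\<^sub>h L)" for x y
        using that LH by (intro bmm_diff[OF RT]) auto
    qed (use y near RL TH LH that in auto)
    then show ?thesis by auto
  qed
  define N2 where "N2 = {x \<in> hset H. R x \<in> {0}}"
  define N where "N = {x \<in> hset H. T x \<in> N2}"
  have N_iff: "x \<in> N \<longleftrightarrow> x \<in> hset H \<and> R (T x) = 0" for x using TH by (auto simp: N_def N2_def)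
  have zero: "closed_submodule H {0}"
    unfolding closed_submodule_def submodule_def
  proof (intro conjI allI impI)
    fix s x assume "\<forall>n. s n \<in> {0::'b}" "x \<in> hset H" "(\<lambda>n. hnorm H (s n - x)) \<longlonglongrightarrow> 0"
    then show "x \<in> {0}"
      using lim_unique[of s 0 x] by simp
  qed (use scaleC_add_right[of _ 0 0] scaleC_eq_act[of 0] act_add[of 0 0] in auto)
  have N2_closed: "closed_submodule H N2" unfolding N2_def by (rule closed_submodule_vimage[OF R zero])
  have N_closed: "closed_submodule H N" unfolding N_def by (rule closed_submodule_vimage[OF T N2_closed])
  have split: "\<exists>l\<in>L. x - l \<in> N" if x: "x \<in> hset H" for x
  proof -
    obtain l where "l \<in> L" "R (T l) = R (T x)" using surj[OF RL[OF TH[OF x]]] by blast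
    then show ?thesis using bmm_diff[OF RT x LH, of l] x LH by (auto simp: N_iff)
  qed
  have d1: "direct_decomp H L N"
    by (rule direct_decompI[OF L N_closed _ split]) (use inj in \<open>auto simp: N_iff\<close>)
  have d2: "direct_decomp H (T ` L) N2"
  proof (rule direct_decompI[OF closed_submodule_image[OF T L hilbert_module_axioms below] N2_closed])
    fix y assume "y \<in> T ` L" "y \<in> N2"
    then show "y = 0" using inj bmm_0[OF T] by (auto simp: N2_def)
  next
    fix y assume y: "y \<in> hset H"
    obtain l where l: "l \<in> L" "R (T l) = R y" using surj[OF RL[OF y]] by blast
    then have "y - T l \<in> N2" using bmm_diff[OF R y TH[OF LH[OF l(1)]]] y TH LH by (auto simp: N2_def)
    then show "\<exists>m\<in>T ` L. y - m \<in> N2" using l by blast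
  qed
  \<comment> \<open>The components of the \<open>v i\<close> in \<open>N\<close> along
    \<open>L\<close> generate \<open>N\<close>: what remains of an element of \<open>N\<close> after
    subtracting them lies in \<open>L\<close>, which meets \<open>N\<close> only in 0.\<close>
  have "\<exists>w. w \<in> N \<and> v i - w \<in> L" if "i \<in> I" for i
    using split[OF I(2)[OF that]] by (metis diff_diff_eq2 add_diff_cancel_left')
  then obtain w where w: "\<And>i. i \<in> I \<Longrightarrow> w i \<in> N" "\<And>i. i \<in> I \<Longrightarrow> v i - w i \<in> L" by metis
  interpret N: hilbert_module "H \<restriction>\<^sub>h N" by (rule hilbert_module_restrict N_closed)+
  have "finitely_generated (H \<restriction>\<^sub>h N)"
  proof (rule N.finitely_generated_if_family[OF I(1), of w])
    fix x assume "x \<in> hset (H \<restriction>\<^sub>h N)"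
    then have x: "x \<in> N" "x \<in> hset H" by (auto simp: N_iff)
    obtain l a where la: "l \<in> L" "x = l + (\<Sum>i\<in>I. hact H (v i) (a i))" using gen[OF x(2)] by blast
    have "hact H (v i) (a i) = hact H (v i - w i) (a i) + hact H (w i) (a i)" if "i \<in> I" for i
      using act_add[of "v i - w i" "w i" "a i"] w[OF that] LH by (simp add: N_iff)
    then have "(\<Sum>i\<in>I. hact H (v i) (a i)) = (\<Sum>i\<in>I. hact H (v i - w i) (a i)) + (\<Sum>i\<in>I. hact H (w i) (a i))"
      by (simp add: sum.distrib)
    then have "x - (\<Sum>i\<in>I. hact H (w i) (a i)) = l + (\<Sum>i\<in>I. hact H (v i - w i) (a i))"
      using la by simp
    moreover have "l + (\<Sum>i\<in>I. hact H (v i - w i) (a i)) \<in> L"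
      using L.add_closed[of l "\<Sum>i\<in>I. hact H (v i - w i) (a i)"]
        L.sum_closed[of I "\<lambda>i. hact H (v i - w i) (a i)"] L.act_closed w la by simp
    moreover have "x - (\<Sum>i\<in>I. hact H (w i) (a i)) \<in> N"
      using N.diff_closed[of x "\<Sum>i\<in>I. hact H (w i) (a i)"]
        N.sum_closed[of I "\<lambda>i. hact H (w i) (a i)"] N.act_closed w x by simp
    ultimately have "x - (\<Sum>i\<in>I. hact H (w i) (a i)) = 0"
      using d1 unfolding direct_decomp_def by auto
    then show "\<exists>a. x = (\<Sum>i\<in>I. hact (H \<restriction>\<^sub>h N) (w i) (a i))" by auto
  qed (use w in auto)
  moreover have "diag_iso_decomp H T L N (T ` L) N2"
    by (rule diag_iso_decompI[OF T d1 d2 refl _ below]) (auto simp: N_def)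
  ultimately show thesis using that by blast
qed

text \<open>\<open>S\<close> is the projection onto \<open>M2\<close> along \<open>N2\<close>
  followed by the inverse of \<open>T\<close> on \<open>M1\<close>, so \<open>x - S (T x)\<close> is
  the \<open>N1\<close>-component of \<open>x\<close>.\<close>

lemma left_inverse_of_diag_iso_decomp:
  assumes T: "bounded_module_map H H T" and "diag_iso_decomp H T M1 N1 M2 N2"
  obtains S where "bounded_module_map H H S" "\<And>x. x \<in> hset H \<Longrightarrow> x - S (T x) \<in> N1"
proof -
  obtain B where d: "direct_decomp H M1 N1" and d': "direct_decomp H M2 N2"
    and img: "T ` M1 = M2" "T ` N1 \<subseteq> N2" and B: "0 < B"
    and below: "\<And>x. x \<in> M1 \<Longrightarrow> hnorm H x \<le> B * hnorm H (T x)"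
    using diag_iso_decompE[OF assms(2)] by blast
  note d1 = direct_decompD[OF d] and d2 = direct_decompD[OF d']
  obtain C where C: "0 < C" "\<And>m n. m \<in> M2 \<Longrightarrow> n \<in> N2 \<Longrightarrow> hnorm H m \<le> C * hnorm H (m + n)"
    using direct_decomp_bound[OF d'] by blast
  interpret M1: hilbert_module "H \<restriction>\<^sub>h M1" by (rule hilbert_module_restrict d1)+
  interpret M2: hilbert_module "H \<restriction>\<^sub>h M2" by (rule hilbert_module_restrict d2)+
  interpret N2: hilbert_module "H \<restriction>\<^sub>h N2" by (rule hilbert_module_restrict d2)+
  have MH: "x \<in> hset H" if "x \<in> M1" for x using d1(5) that by blast
  have uniq: "m = m'" if "m \<in> M1" "m' \<in> M1" "y - T m \<in> N2" "y - T m' \<in> N2" for m m' y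
  proof -
    have mm: "m - m' \<in> M1" using M1.diff_closed[of m m'] that by simp
    have "T (m - m') = (y - T m') - (y - T m)" using that MH by (simp add: bmm_diff[OF T])
    also have "\<dots> \<in> N2" using N2.diff_closed[of "y - T m'" "y - T m"] that by simp
    finally have "T (m - m') \<in> N2" .
    then have "T (m - m') = 0" using mm img(1) d2(3) by blast
    then have "hnorm H (m - m') \<le> 0" using below[OF mm] by simp
    then show ?thesis using hnorm_eq_0[OF MH[OF mm]] hnorm_nonneg[of H "m - m'"] by simp
  qed
  have ex: "\<exists>m. m \<in> M1 \<and> y - T m \<in> N2" if "y \<in> hset H" for y
    using d2(4)[OF that] img(1) by force
  \<comment> \<open>The property determines the value uniquely, so additivity and compatibility with
    scalars and the action reduce to checking it for the expected value.\<close>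
  define S where "S y = (SOME m. m \<in> M1 \<and> y - T m \<in> N2)" for y
  have S: "S y \<in> M1" "y - T (S y) \<in> N2" if "y \<in> hset H" for y
    using someI_ex[OF ex[OF that]] by (auto simp: S_def)
  have SI: "S y = m" if "y \<in> hset H" "m \<in> M1" "y - T m \<in> N2" for y m
    using uniq S that by blast
  have bS: "bounded_module_map H H S"
    unfolding bounded_module_map_def
  proof (intro conjI ballI allI exI)
    fix x y assume xy: "x \<in> hset H" "y \<in> hset H"
    have "(x + y) - T (S x + S y) = (x - T (S x)) + (y - T (S y))"
      using xy S MH by (simp add: bmm_add[OF T])
    also have "\<dots> \<in> N2" using N2.add_closed[of "x - T (S x)" "y - T (S y)"] S xy by simp
    finally show "S (x + y) = S x + S y" using xy S M1.add_closed by (intro SI) auto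
  next
    fix x c assume x: "x \<in> hset H"
    have "c *\<^sub>C x - T (c *\<^sub>C S x) = c *\<^sub>C (x - T (S x))"
      using x S MH scaleC_add_right[of c x "- T (S x)"] by (simp add: bmm_scaleC[OF T] scaleC_minus_right)
    also have "\<dots> \<in> N2" using N2.scaleC_closed S x by simp
    finally show "S (c *\<^sub>C x) = c *\<^sub>C S x" using x S M1.scaleC_closed by (intro SI) auto
  next
    fix x a assume x: "x \<in> hset H"
    have "hact H x a - T (hact H (S x) a) = hact H (x - T (S x)) a"
      using x S MH act_add[of x "- T (S x)" a] by (simp add: bmm_act[OF T] act_minus bmm_closed[OF T])
    also have "\<dots> \<in> N2" using N2.act_closed S x by simp
    finally show "S (hact H x a) = hact H (S x) a" using x S M1.act_closed by (intro SI) auto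
  next
    fix x assume x: "x \<in> hset H"
    have "hnorm H (S x) \<le> B * hnorm H (T (S x))" by (rule below[OF S(1)[OF x]])
    also have "\<dots> \<le> B * (C * hnorm H (T (S x) + (x - T (S x))))"
      using B S x img(1) by (intro mult_left_mono C) auto
    finally show "hnorm H (S x) \<le> (B * C) * hnorm H x" by simp
  qed (use S MH in auto)
  have "x - S (T x) \<in> N1" if x: "x \<in> hset H" for x
  proof -
    obtain m n where mn: "m \<in> M1" "n \<in> N1" "x = m + n" using d1(4)[OF x] by blast
    then have "T x - T m = T n" using MH d1(6) by (simp add: bmm_add[OF T] subset_iff)
    then have "S (T x) = m" using mn img(2) bmm_closed[OF T x] by (intro SI) auto
    then show ?thesis using mn by simp
  qed
  then show thesis using bS that by blast
qed

end

section \<open>Operator matrices\<close>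

lemma bounded_module_map_id: "bounded_module_map H H id"
  by (auto simp: bounded_module_map_def intro: exI[of _ 1])

lemma bounded_module_map_zero:
  assumes "semi_inner_module K"
  shows "bounded_module_map H K 0"
proof -
  interpret K: semi_inner_module K by fact
  show ?thesis
    using K.act_add[of 0 0] scaleC_add_right[of _ 0 0]
    by (auto simp: bounded_module_map_def intro: exI[of _ 0])
qed

lemma bounded_module_map_uminus:
  assumes "semi_inner_module K" "bounded_module_map H K T"
  shows "bounded_module_map H K (- T)"
proof -
  interpret K: semi_inner_module K by fact
  show ?thesis
    using assms(2) unfolding bounded_module_map_def
    by (auto simp: scaleC_minus_right K.act_minus K.hnorm_minus image_subset_iff)
qed

lemma bounded_module_map_op_matrix:
  assumes HK: "semi_inner_module H" "semi_inner_module K"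
    and P: "bounded_module_map H H P" and Q: "bounded_module_map K H Q"
    and R: "bounded_module_map H K R" and S: "bounded_module_map K K S"
  shows "bounded_module_map (H \<oplus>\<^sub>h K) (H \<oplus>\<^sub>h K) (op_matrix P Q R S)"
proof -
  interpret H: semi_inner_module H by fact
  interpret K: semi_inner_module K by fact
  obtain p where p: "0 < p" "\<And>x. x \<in> hset H \<Longrightarrow> hnorm H (P x) \<le> p * hnorm H x"
    using bounded_module_map_bound[OF P] by blast
  obtain q where q: "0 < q" "\<And>x. x \<in> hset K \<Longrightarrow> hnorm H (Q x) \<le> q * hnorm K x"
    using bounded_module_map_bound[OF Q] by blast
  obtain r where r: "0 < r" "\<And>x. x \<in> hset H \<Longrightarrow> hnorm K (R x) \<le> r * hnorm H x"
    using bounded_module_map_bound[OF R] by blast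
  obtain s where s: "0 < s" "\<And>x. x \<in> hset K \<Longrightarrow> hnorm K (S x) \<le> s * hnorm K x"
    using bounded_module_map_bound[OF S] by blast
  have closed: "P x + Q y \<in> hset H" "R x + S y \<in> hset K" if "x \<in> hset H" "y \<in> hset K" for x y
    using that bmm_closed[OF P] bmm_closed[OF Q] bmm_closed[OF R] bmm_closed[OF S] by auto
  have "hnorm (H \<oplus>\<^sub>h K) (op_matrix P Q R S z) \<le> (p + r + (q + s)) * hnorm (H \<oplus>\<^sub>h K) z"
    if z: "z \<in> hset (H \<oplus>\<^sub>h K)" for z
  proof -
    obtain x y where xy: "z = (x, y)" "x \<in> hset H" "y \<in> hset K" using z by auto
    have "hnorm (H \<oplus>\<^sub>h K) (op_matrix P Q R S z) \<le> hnorm H (P x + Q y) + hnorm K (R x + S y)"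
      using hnorm_hsum_le[OF HK, of "(P x + Q y, R x + S y)"] closed xy by (simp add: op_matrix_def)
    also have "\<dots> \<le> (hnorm H (P x) + hnorm H (Q y)) + (hnorm K (R x) + hnorm K (S y))"
      using xy bmm_closed[OF P] bmm_closed[OF Q] bmm_closed[OF R] bmm_closed[OF S]
      by (intro add_mono H.hnorm_triangle K.hnorm_triangle) auto
    also have "\<dots> \<le> (p * hnorm H x + q * hnorm K y) + (r * hnorm H x + s * hnorm K y)"
      using xy by (intro add_mono p q r s)
    also have "\<dots> = (p + r) * hnorm H x + (q + s) * hnorm K y" by (simp add: algebra_simps)
    also have "\<dots> \<le> (p + r) * hnorm (H \<oplus>\<^sub>h K) z + (q + s) * hnorm (H \<oplus>\<^sub>h K) z"
      using hnorm_fst_le[OF HK, of z] hnorm_snd_le[OF HK, of z] p q r s xy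
      by (intro add_mono mult_left_mono) auto
    finally show ?thesis by (simp add: algebra_simps)
  qed
  then have "\<exists>B. \<forall>z\<in>hset (H \<oplus>\<^sub>h K). hnorm (H \<oplus>\<^sub>h K) (op_matrix P Q R S z) \<le> B * hnorm (H \<oplus>\<^sub>h K) z"
    by blast
  then show ?thesis
    unfolding bounded_module_map_def
    using closed
    by (auto simp: op_matrix_def scaleC_prod_def scaleC_add_right H.act_add K.act_add
        bmm_add[OF P] bmm_add[OF Q] bmm_add[OF R] bmm_add[OF S]
        bmm_scaleC[OF P] bmm_scaleC[OF Q] bmm_scaleC[OF R] bmm_scaleC[OF S]
        bmm_act[OF P] bmm_act[OF Q] bmm_act[OF R] bmm_act[OF S]
        bmm_closed[OF P] bmm_closed[OF Q] bmm_closed[OF R] bmm_closed[OF S])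
qed

lemma op_matrix_diag_adjointable:
  assumes HK: "semi_inner_module H" "semi_inner_module K" and F: "F \<in> B\<^sup>a H"
  shows "op_matrix F 0 0 id \<in> B\<^sup>a (H \<oplus>\<^sub>h K)"
proof -
  obtain S where "S ` hset H \<subseteq> hset H" "\<forall>x\<in>hset H. \<forall>y\<in>hset H. hinner H (F x) y = hinner H x (S y)"
    and bF: "bounded_module_map H H F"
    using F unfolding adjointable_ops_def by blast
  then have "op_matrix S 0 0 id ` hset (H \<oplus>\<^sub>h K) \<subseteq> hset (H \<oplus>\<^sub>h K) \<and>
    (\<forall>p\<in>hset (H \<oplus>\<^sub>h K). \<forall>q\<in>hset (H \<oplus>\<^sub>h K).
      hinner (H \<oplus>\<^sub>h K) (op_matrix F 0 0 id p) q = hinner (H \<oplus>\<^sub>h K) p (op_matrix S 0 0 id q))"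
    by (auto simp: op_matrix_def)
  moreover have "bounded_module_map (H \<oplus>\<^sub>h K) (H \<oplus>\<^sub>h K) (op_matrix F 0 0 id)"
    by (intro bounded_module_map_op_matrix HK bF bounded_module_map_zero bounded_module_map_id)
  ultimately show ?thesis unfolding adjointable_ops_def by blast
qed

section \<open>Fredholm operators on the standard module\<close>

lemma bounded_module_map_tail: "bounded_module_map H\<^sub>A H\<^sub>A (tail n)"
  unfolding bounded_module_map_def
proof (intro conjI ballI allI exI)
  show "hnorm H\<^sub>A (tail n x) \<le> 1 * hnorm H\<^sub>A x" if "x \<in> hset H\<^sub>A" for x :: "nat \<Rightarrow> 'a"
    using hnorm_tail_le[OF that] by simp
  show "tail n ` hset H\<^sub>A \<subseteq> hset H\<^sub>A" using tail_closed by blast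
qed (auto simp: tail_def fun_eq_iff scaleC_fun_def scaleC_add_right[of _ 0 0, simplified])

text \<open>The sequences vanishing before \<open>n\<close>, written as fixed points of the
  projection \<open>tail n\<close>; closedness is then continuity plus uniqueness of limits.\<close>

lemma tail_kernel_closed: "closed_submodule H\<^sub>A {x \<in> hset H\<^sub>A. tail n x = x}"
  unfolding closed_submodule_def submodule_def
proof (intro conjI ballI allI impI)
  fix s :: "nat \<Rightarrow> nat \<Rightarrow> 'a" and x
  assume s: "\<forall>j. s j \<in> {x \<in> hset H\<^sub>A. tail n x = x}" and x: "x \<in> hset H\<^sub>A"
    and lim: "(\<lambda>j. hnorm H\<^sub>A (s j - x)) \<longlonglongrightarrow> 0"
  have "(\<lambda>j. hnorm H\<^sub>A (tail n (s j) - tail n x)) \<longlonglongrightarrow> 0"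
    by (rule std.bmm_lim[OF bounded_module_map_tail _ x lim]) (use s in blast)
  then have "tail n x = x"
    using s by (intro std.lim_unique[OF _ tail_closed[OF x] x _ lim]) auto
  then show "x \<in> {x \<in> hset H\<^sub>A. tail n x = x}" using x by simp
qed (auto simp: bmm_add[OF bounded_module_map_tail] bmm_scaleC[OF bounded_module_map_tail]
      bmm_act[OF bounded_module_map_tail] std.bmm_0[OF bounded_module_map_tail] simp del: std_hmod_simps)

definition unit_vec :: "nat \<Rightarrow> nat \<Rightarrow> 'a::unital_cstar_algebra"
  where "unit_vec i = (\<lambda>k. if k = i then 1 else 0)"

lemma unit_vec_closed: "unit_vec i \<in> hset (H\<^sub>A :: ('a::unital_cstar_algebra, nat \<Rightarrow> 'a) hmod)"
proof -
  have "summable (\<lambda>n. star (unit_vec i n) * unit_vec i n :: 'a)"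
    by (rule summable_finite[of "{i}"]) (auto simp: unit_vec_def)
  then show ?thesis by simp
qed

lemma sum_apply: "sum f I x = (\<Sum>i\<in>I. f i x :: 'a::comm_monoid_add)"
  by (induction I rule: infinite_finite_induct) auto

lemma tail_plus_unit_vecs: "x = tail n x + (\<Sum>i<n. hact H\<^sub>A (unit_vec i) (x i))"
proof
  fix k
  have "(\<Sum>i<n. hact H\<^sub>A (unit_vec i) (x i)) k = (\<Sum>i<n. if i = k then x i else 0)"
    unfolding sum_apply by (intro sum.cong) (auto simp: unit_vec_def)
  then show "x k = (tail n x + (\<Sum>i<n. hact H\<^sub>A (unit_vec i) (x i))) k"
    by (simp add: tail_def)
qed

text \<open>For \<open>x\<close> in \<open>L\<close> the error \<open>(0, x) - S (0, D x)\<close>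
  lies in \<open>N1\<close>, so its second coordinate combines finitely many fixed vectors with
  coefficients bounded by a multiple of the norm of \<open>x\<close>. Cutting off initial
  coordinates makes it small uniformly in \<open>x\<close>.\<close>

lemma diag_iso_decomp_of_op_matrix_id:
  fixes D :: "(nat \<Rightarrow> 'a::unital_cstar_algebra) \<Rightarrow> nat \<Rightarrow> 'a"
  assumes D: "bounded_module_map H\<^sub>A H\<^sub>A D"
    and dec: "diag_iso_decomp (H\<^sub>A \<oplus>\<^sub>h H\<^sub>A) (op_matrix id 0 0 D) M1 N1 M2 N2"
    and fg: "finitely_generated ((H\<^sub>A \<oplus>\<^sub>h H\<^sub>A) \<restriction>\<^sub>h N1)"
  shows "\<exists>M1 N1 M2 N2. diag_iso_decomp H\<^sub>A D M1 N1 M2 N2 \<and> finitely_generated (H\<^sub>A \<restriction>\<^sub>h N1)"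
proof -
  let ?H = "H\<^sub>A :: ('a, nat \<Rightarrow> 'a) hmod" and ?G = "H\<^sub>A \<oplus>\<^sub>h H\<^sub>A :: ('a, (nat \<Rightarrow> 'a) \<times> (nat \<Rightarrow> 'a)) hmod"
  let ?D' = "op_matrix id 0 0 D"
  note semi = semi_inner_module_std semi_inner_module_std
  have bD': "bounded_module_map ?G ?G ?D'"
    by (intro bounded_module_map_op_matrix semi bounded_module_map_zero bounded_module_map_id D)
  obtain S where S: "bounded_module_map ?G ?G S" "\<And>p. p \<in> hset ?G \<Longrightarrow> p - S (?D' p) \<in> N1"
    using std2.left_inverse_of_diag_iso_decomp[OF bD' dec] by blast
  obtain E where E: "0 < E" "\<And>p. p \<in> hset ?G \<Longrightarrow> hnorm ?G ((S \<circ> ?D') p) \<le> E * hnorm ?G p"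
    using bounded_module_map_bound[OF bounded_module_map_comp[OF bD' S(1)]] by blast
  have N1: "closed_submodule ?G N1" "N1 \<subseteq> hset ?G"
    using dec closed_submoduleD(2)[of ?G N1] unfolding diag_iso_decomp_def direct_decomp_def by blast+
  interpret N: hilbert_module "?G \<restriction>\<^sub>h N1" by (rule std2.hilbert_module_restrict[OF N1(1)])
  have restrict: "hset (?G \<restriction>\<^sub>h N1) = N1" "hact (?G \<restriction>\<^sub>h N1) = hact ?G" by simp_all
  obtain V C where V: "finite V" "V \<subseteq> N1" and C: "0 < C"
    and gen: "\<And>p. p \<in> N1 \<Longrightarrow> \<exists>a. p = (\<Sum>s\<in>V. hact ?G s (a s)) \<and> (\<forall>s\<in>V. norm (a s) \<le> C * hnorm ?G p)"
    using N.finitely_generated_bound[OF fg] unfolding restrict hnorm_restrict by blast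
  have VH: "snd s \<in> hset ?H" if "s \<in> V" for s using V(2) N1(2) that by auto
  have "(\<lambda>n. (\<Sum>s\<in>V. hnorm ?H (tail n (snd s)) * C) * (1 + E)) \<longlonglongrightarrow> 0"
    by (intro tendsto_mult_left_zero tendsto_null_sum hnorm_tail_LIMSEQ VH)
  \<comment> \<open>\<open>C * (1 + E)\<close> turns the norm of \<open>x\<close> into a bound for
    the coefficients of the error; \<open>n\<close> is so large that the tails of the generators
    bring the total factor below 1/2, the constant required for bijectivity on
    \<open>L\<close>.\<close>
  then obtain n where n: "(\<Sum>s\<in>V. hnorm ?H (tail n (snd s)) * C) * (1 + E) < 1 / 2"
    using eventually_happens'[OF sequentially_bot order_tendstoD(2)[of _ 0 sequentially "1/2"]] by fastforce
  define L where "L = {x \<in> hset ?H. tail n x = x}"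
  have bt: "bounded_module_map ?H ?H (tail n)" by (rule bounded_module_map_tail)
  have hnorm_inj: "hnorm ?G (0, x) \<le> hnorm ?H x" if "x \<in> hset ?H" for x
    using hnorm_hsum_le[OF semi, of "(0, x)"] that std.zero_closed by (simp del: std_hmod_simps)
  have binj: "bounded_module_map ?H ?G (Pair 0)"
    unfolding bounded_module_map_def
  proof (intro conjI ballI allI exI)
    show "hnorm ?G (0, x) \<le> 1 * hnorm ?H x" if "x \<in> hset ?H" for x
      using hnorm_inj[OF that] by simp
  qed (use std.zero_closed scaleC_add_right[of _ "0::nat \<Rightarrow> 'a" 0] in
        \<open>auto simp: scaleC_prod_def fun_eq_iff simp del: std_hmod_simps(1)\<close>)
  have bsnd: "bounded_module_map ?G ?H snd"
    unfolding bounded_module_map_def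
  proof (intro conjI ballI allI exI)
    show "hnorm ?H (snd p) \<le> 1 * hnorm ?G p" if "p \<in> hset ?G" for p
      using hnorm_snd_le[OF semi, of p] that by (simp del: std_hmod_simps)
  qed (auto simp: scaleC_prod_def simp del: std_hmod_simps)
  \<comment> \<open>The left inverse modulo \<open>N1\<close>, entered and left through the second
    coordinate; the final truncation puts the values into \<open>L\<close>.\<close>
  define R where "R = tail n \<circ> (snd \<circ> (S \<circ> Pair 0))"
  have bR: "bounded_module_map ?H ?H R"
    unfolding R_def
    by (rule bounded_module_map_comp[OF bounded_module_map_comp[OF bounded_module_map_comp[OF binj S(1)] bsnd] bt])
  have Lmem: "tail n x \<in> L" if "x \<in> hset ?H" for x
    using tail_closed[OF that] by (simp add: L_def) (simp add: tail_def fun_eq_iff)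
  have near: "hnorm ?H (x - R (D x)) \<le> hnorm ?H x / 2" if "x \<in> L" for x
  proof -
    have x: "x \<in> hset ?H" "tail n x = x" using that by (auto simp: L_def)
    have p: "(0, x) \<in> hset ?G" using bmm_closed[OF binj x(1)] .
    have D'p: "?D' (0, x) = (0, D x)" by (simp add: op_matrix_def)
    define v where "v = (0, x) - S (0, D x)"
    have v: "v \<in> N1" "v \<in> hset ?G" using S(2)[OF p] N1(2) unfolding v_def D'p by auto
    have SG: "S (0, D x) \<in> hset ?G" using bmm_closed[OF S(1) bmm_closed[OF bD' p]] by (simp only: D'p)
    \<comment> \<open>Because \<open>tail n x = x\<close>, the truncation can be pulled in front of
      the whole error.\<close>
    have "x - R (D x) = tail n (snd v)"
      using std.bmm_diff[OF bt x(1), of "snd (S (0, D x))"] bmm_closed[OF bsnd SG] x(2)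
      by (simp add: R_def v_def)
    moreover obtain a where a: "v = (\<Sum>s\<in>V. hact ?G s (a s))" "\<forall>s\<in>V. norm (a s) \<le> C * hnorm ?G v"
      using gen[OF v(1)] by blast
    have "tail n (snd v) = (\<Sum>s\<in>V. hact ?H (tail n (snd s)) (a s))"
    proof -
      have "tail n (snd v) = tail n (\<Sum>s\<in>V. hact ?H (snd s) (a s))" unfolding a(1) by (simp add: snd_sum)
      also have "\<dots> = (\<Sum>s\<in>V. tail n (hact ?H (snd s) (a s)))"
        by (intro std.bmm_sum[OF bt] std.act_closed VH)
      also have "\<dots> = (\<Sum>s\<in>V. hact ?H (tail n (snd s)) (a s))"
        by (intro sum.cong refl bmm_act[OF bt] VH)
      finally show ?thesis .
    qed
    moreover have "hnorm ?H (\<Sum>s\<in>V. hact ?H (tail n (snd s)) (a s)) \<le>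
        (\<Sum>s\<in>V. hnorm ?H (tail n (snd s)) * (C * hnorm ?G v))"
    proof (rule order_trans[OF std.hnorm_sum sum_mono])
      fix s assume s: "s \<in> V"
      show "hact ?H (tail n (snd s)) (a s) \<in> hset ?H" by (intro std.act_closed tail_closed VH s)
      have "hnorm ?H (hact ?H (tail n (snd s)) (a s)) \<le> hnorm ?H (tail n (snd s)) * norm (a s)"
        by (intro std.hnorm_act tail_closed VH s)
      also have "\<dots> \<le> hnorm ?H (tail n (snd s)) * (C * hnorm ?G v)"
        using a(2) s by (intro mult_left_mono) auto
      finally show "hnorm ?H (hact ?H (tail n (snd s)) (a s)) \<le> hnorm ?H (tail n (snd s)) * (C * hnorm ?G v)" .
    qed
    ultimately have 1: "hnorm ?H (x - R (D x)) \<le> (\<Sum>s\<in>V. hnorm ?H (tail n (snd s)) * C) * hnorm ?G v"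
      by (simp add: sum_distrib_right mult.assoc del: std_hmod_simps)
    have "hnorm ?G v \<le> hnorm ?G (0, x) + hnorm ?G (S (0, D x))"
      unfolding v_def by (rule std2.hnorm_diff_le[OF p SG])
    also have "\<dots> \<le> (1 + E) * hnorm ?G (0, x)"
      using E(2)[OF p] by (simp add: D'p algebra_simps)
    also have "\<dots> \<le> (1 + E) * hnorm ?H x"
      using E(1) hnorm_inj[OF x(1)] by (intro mult_left_mono) auto
    finally have 2: "hnorm ?G v \<le> (1 + E) * hnorm ?H x" .
    have "hnorm ?H (x - R (D x)) \<le> (\<Sum>s\<in>V. hnorm ?H (tail n (snd s)) * C) * ((1 + E) * hnorm ?H x)"
      using C by (intro order_trans[OF 1] mult_left_mono 2 sum_nonneg) auto
    also have "\<dots> = ((\<Sum>s\<in>V. hnorm ?H (tail n (snd s)) * C) * (1 + E)) * hnorm ?H x"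
      by (simp only: mult.assoc)
    also have "\<dots> \<le> (1 / 2) * hnorm ?H x"
      using n by (intro mult_right_mono) auto
    finally show ?thesis by simp
  qed
  have Lc: "closed_submodule ?H L" unfolding L_def by (rule tail_kernel_closed)
  have RL: "R x \<in> L" if "x \<in> hset ?H" for x
    unfolding R_def o_def
    by (rule Lmem[OF bmm_closed[OF bsnd bmm_closed[OF S(1) bmm_closed[OF binj that]]]])
  have gens: "\<exists>l\<in>L. \<exists>a. x = l + (\<Sum>i\<in>{..<n}. hact ?H (unit_vec i) (a i))" if "x \<in> hset ?H" for x
    using tail_plus_unit_vecs[of x n] Lmem[OF that] by blast
  show ?thesis
    using std.diag_iso_decomp_of_left_inverse[OF D bR Lc RL near finite_lessThan unit_vec_closed gens] by blast
qed

theorem theorem3p16: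
  fixes F C D :: "(nat \<Rightarrow> 'a::unital_cstar_algebra) \<Rightarrow> nat \<Rightarrow> 'a"
  assumes "F \<in> B\<^sup>a H\<^sub>A" "C \<in> B\<^sup>a H\<^sub>A" "D \<in> B\<^sup>a H\<^sub>A"
    and "op_matrix F C 0 D \<in> M\<Phi>\<^sub>+ (H\<^sub>A \<oplus>\<^sub>h H\<^sub>A)"
  defines "F' \<equiv> op_matrix F 0 0 id" and "D' \<equiv> op_matrix id 0 0 D"
  shows "F' \<in> M\<Phi>\<^sub>+ (H\<^sub>A \<oplus>\<^sub>h H\<^sub>A) \<and>
    (D \<in> M\<Phi>\<^sub>+ H\<^sub>A \<or>
      (\<exists>M1 N1 M2 N2 M1' N1' M2' N2'.
        diag_iso_decomp (H\<^sub>A \<oplus>\<^sub>h H\<^sub>A) F' M1 N1 M2 N2 \<and>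
        diag_iso_decomp (H\<^sub>A \<oplus>\<^sub>h H\<^sub>A) D' M1' N1' M2' N2' \<and>
        (H\<^sub>A \<oplus>\<^sub>h H\<^sub>A) \<restriction>\<^sub>h M2 \<cong>\<^sub>h (H\<^sub>A \<oplus>\<^sub>h H\<^sub>A) \<restriction>\<^sub>h M1' \<and>
        (H\<^sub>A \<oplus>\<^sub>h H\<^sub>A) \<restriction>\<^sub>h N2 \<cong>\<^sub>h (H\<^sub>A \<oplus>\<^sub>h H\<^sub>A) \<restriction>\<^sub>h N1' \<and>
        finitely_generated ((H\<^sub>A \<oplus>\<^sub>h H\<^sub>A) \<restriction>\<^sub>h N1) \<and>
        \<not> finitely_generated ((H\<^sub>A \<oplus>\<^sub>h H\<^sub>A) \<restriction>\<^sub>h N2) \<and>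
        \<not> finitely_generated ((H\<^sub>A \<oplus>\<^sub>h H\<^sub>A) \<restriction>\<^sub>h N1')))"
proof -
  let ?G = "H\<^sub>A \<oplus>\<^sub>h H\<^sub>A :: ('a, (nat \<Rightarrow> 'a) \<times> (nat \<Rightarrow> 'a)) hmod"
  have bF: "bounded_module_map H\<^sub>A H\<^sub>A F" and bC: "bounded_module_map H\<^sub>A H\<^sub>A C"
    and bD: "bounded_module_map H\<^sub>A H\<^sub>A D"
    using assms(1-3) unfolding adjointable_ops_def by blast+
  note semi = semi_inner_module_std
  note bmm = bounded_module_map_op_matrix[OF semi semi] bounded_module_map_zero[OF semi]
    bounded_module_map_id bounded_module_map_uminus[OF semi]
  define C' where "C' = op_matrix id C 0 id"
  \<comment> \<open>The inverse of \<open>C'\<close>: changing the sign of the upper right entry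
    inverts a unipotent matrix.\<close>
  define J where "J = op_matrix id (- C) 0 id"
  have bF': "bounded_module_map ?G ?G F'" unfolding F'_def by (intro bmm bF)
  have bD': "bounded_module_map ?G ?G D'" unfolding D'_def by (intro bmm bD)
  have bC': "bounded_module_map ?G ?G C'" unfolding C'_def by (intro bmm bC)
  have bJ: "bounded_module_map ?G ?G J" unfolding J_def by (intro bmm bC)
  have JC: "J (C' p) = p" and CJ: "C' (J p) = p" for p
    by (simp_all add: J_def C'_def op_matrix_def split_beta)
  have factor: "op_matrix F C 0 D = (D' \<circ> C') \<circ> F'"
    by (auto simp: fun_eq_iff op_matrix_def F'_def C'_def D'_def)
  obtain M1 N1 M2 N2 where dec: "diag_iso_decomp ?G ((D' \<circ> C') \<circ> F') M1 N1 M2 N2"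
    and fg: "finitely_generated (?G \<restriction>\<^sub>h N1)"
    using assms(4) unfolding upper_semi_Fredholm_def factor by blast
  define X where "X = F' ` M1"
  \<comment> \<open>\<open>Y\<close> is the preimage of \<open>Y'\<close> under \<open>C'\<close>.
    It will be the complement in the codomain of \<open>F'\<close>, and \<open>Y'\<close> the
    complement in the domain of \<open>D'\<close>.\<close>
  define Y where "Y = {p \<in> hset ?G. (D' \<circ> C') p \<in> N2}"
  define Y' where "Y' = {p \<in> hset ?G. D' p \<in> N2}"
  note bDC = bounded_module_map_comp[OF bC' bD']
  have decF: "diag_iso_decomp ?G F' M1 N1 X Y" and decDC: "diag_iso_decomp ?G (D' \<circ> C') X Y M2 N2"
    unfolding X_def Y_def by (rule std2.diag_iso_decomp_factor[OF bF' bDC dec])+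
  have decC: "diag_iso_decomp ?G C' X Y (C' ` X) Y'" and decD: "diag_iso_decomp ?G D' (C' ` X) Y' M2 N2"
    unfolding Y'_def by (rule std2.diag_iso_decomp_factor[OF bC' bD' decDC])+
  have XX: "module_iso (?G \<restriction>\<^sub>h X) (?G \<restriction>\<^sub>h C' ` X) C'"
    using decC by (simp add: diag_iso_decomp_def)
  have Yc: "closed_submodule ?G Y" "closed_submodule ?G Y'"
    using decC unfolding diag_iso_decomp_def direct_decomp_def by blast+
  interpret Y: hilbert_module "?G \<restriction>\<^sub>h Y" by (rule std2.hilbert_module_restrict[OF Yc(1)])
  have semiY': "semi_inner_module (?G \<restriction>\<^sub>h Y')"
    by (rule std2.semi_inner_module_restrict[OF closed_submoduleD(1)[OF Yc(2)]])
  have imgY: "C' ` Y = Y'"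
  proof (intro equalityI subsetI)
    fix p assume "p \<in> Y'"
    then have "J p \<in> Y" using bmm_closed[OF bJ] by (simp add: Y_def Y'_def CJ)
    then show "p \<in> C' ` Y" using CJ[of p] by (intro image_eqI[of _ _ "J p"]) simp_all
  next
    fix q assume "q \<in> C' ` Y"
    then show "q \<in> Y'" using bmm_closed[OF bC'] unfolding Y_def Y'_def o_def by blast
  qed
  obtain B where B: "0 < B" "\<And>p. p \<in> hset ?G \<Longrightarrow> hnorm ?G (J p) \<le> B * hnorm ?G p"
    using bounded_module_map_bound[OF bJ] by blast
  \<comment> \<open>\<open>C'\<close> is bounded below because its inverse \<open>J\<close> is
    bounded.\<close>
  have YY: "module_iso (?G \<restriction>\<^sub>h Y) (?G \<restriction>\<^sub>h Y') C'"
  proof (rule Y.module_iso_if_bounded_below[OF _ _ semiY'])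
    show "bounded_module_map (?G \<restriction>\<^sub>h Y) (?G \<restriction>\<^sub>h Y') C'"
      using closed_submoduleD(2)[OF Yc(1)] imgY by (intro bounded_module_map_restrict[OF bC']) auto
    fix p assume "p \<in> hset (?G \<restriction>\<^sub>h Y)"
    then have "p \<in> hset ?G" using closed_submoduleD(2)[OF Yc(1)] by auto
    then show "hnorm (?G \<restriction>\<^sub>h Y) p \<le> B * hnorm (?G \<restriction>\<^sub>h Y') (C' p)"
      using B(2)[OF bmm_closed[OF bC']] by (simp only: JC hnorm_restrict)
  qed (simp add: imgY)
  have "F' \<in> M\<Phi>\<^sub>+ ?G"
    using op_matrix_diag_adjointable[OF semi semi assms(1)] decF fg
    unfolding upper_semi_Fredholm_def F'_def by blast
  \<comment> \<open>The case distinction is on finite generation of \<open>Y'\<close>; where it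
    fails, it fails for \<open>Y\<close> too, by transfer along \<open>C'\<close>.\<close>
  moreover have "D \<in> M\<Phi>\<^sub>+ H\<^sub>A" if "finitely_generated (?G \<restriction>\<^sub>h Y')"
    using diag_iso_decomp_of_op_matrix_id[OF bD decD[unfolded D'_def] that] assms(3)
    unfolding upper_semi_Fredholm_def by blast
  moreover have "finitely_generated (?G \<restriction>\<^sub>h Y')" if "finitely_generated (?G \<restriction>\<^sub>h Y)"
    by (rule Y.finitely_generated_iso[OF YY semiY' that])
  ultimately show ?thesis
    using decF decD fg XX YY unfolding isomorphic_modules_def by blast
qed

end
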